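(* Let $k$ be a field containing all roots of unity, with separable Galois group $G_k$ (the Galois group of a separable closure of $k$ over $k$). Then $G_k$ is totally torsion free.
   Context: A profinite group $G$ is called totally torsion free if for every (closed) subgroup $K\subseteq G$ the quotient $K/[K,K]$ (the abelianization of $K$ in profinite groups, i.e. the quotient by the closed commutator subgroup) is torsion free. *)

theory Defs
  imports "HOL-Analysis.Analysis" "HOL-Algebra.Algebra" "HOL-Algebra.Algebraic_Closure_Type"
    "HOL-Computational_Algebra.Computational_Algebra"
begin

section \<open>Profinite groups\<close>

definition topological_group :: "('g, 'm) monoid_scheme \<Rightarrow> 'g topology \<Rightarrow> bool" where
  "topological_group G T \<longleftrightarrow>
     group G \<and> topspace T = carrier G \<and>
     continuous_map (prod_topology T T) T (\<lambda>(x, y). x \<otimes>\<^bsub>G\<^esub> y) \<and>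
     continuous_map T T (\<lambda>x. inv\<^bsub>G\<^esub> x)"

definition profinite_group :: "('g, 'm) monoid_scheme \<Rightarrow> 'g topology \<Rightarrow> bool" where
  "profinite_group G T \<longleftrightarrow>
     topological_group G T \<and> compact_space T \<and> Hausdorff_space T \<and>
     (\<forall>x\<in>topspace T. connected_component_of_set T x = {x})"

definition torsion_free_group :: "('g, 'm) monoid_scheme \<Rightarrow> bool" where
  "torsion_free_group G \<longleftrightarrow>
     (\<forall>x\<in>carrier G. \<forall>n::nat. n > 0 \<longrightarrow> x [^]\<^bsub>G\<^esub> n = \<one>\<^bsub>G\<^esub> \<longrightarrow> x = \<one>\<^bsub>G\<^esub>)"

definition profinite_abelianization :: "('g, 'm) monoid_scheme \<Rightarrow> 'g topology \<Rightarrow> 'g set monoid" where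
  "profinite_abelianization G T = G Mod (T closure_of derived G (carrier G))"

definition totally_torsion_free :: "('g, 'm) monoid_scheme \<Rightarrow> 'g topology \<Rightarrow> bool" where
  "totally_torsion_free G T \<longleftrightarrow>
     profinite_group G T \<and>
     (\<forall>K. subgroup K G \<longrightarrow> closedin T K \<longrightarrow>
        torsion_free_group (profinite_abelianization (G\<lparr>carrier := K\<rparr>) (subtopology T K)))"

section \<open>Separable closures\<close>

text \<open>A field extension \<open>L / k\<close> is given by an embedding \<open>\<iota>\<close> of the field \<open>'k\<close> into the field \<open>'l\<close>.\<close>

definition field_embedding :: "('k::field \<Rightarrow> 'l::field) \<Rightarrow> bool" where
  "field_embedding \<iota> \<longleftrightarrow>
     \<iota> 1 = 1 \<and> (\<forall>x y. \<iota> (x + y) = \<iota> x + \<iota> y) \<and> (\<forall>x y. \<iota> (x * y) = \<iota> x * \<iota> y)"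

text \<open>Coprimality to the derivative expresses that a polynomial has no repeated root in any
  extension field. The irreducible polynomial in \<open>separable_element\<close> is, up to a unit, the
  minimal polynomial.\<close>

definition separable_polynomial :: "'a::field poly \<Rightarrow> bool" where
  "separable_polynomial p \<longleftrightarrow> coprime p (pderiv p)"

definition separable_element :: "('k::field \<Rightarrow> 'l::field) \<Rightarrow> 'l \<Rightarrow> bool" where
  "separable_element \<iota> x \<longleftrightarrow>
     (\<exists>p. Factorial_Ring.irreducible p \<and> separable_polynomial p \<and> poly (map_poly \<iota> p) x = 0)"

definition separable_closure :: "('k::field \<Rightarrow> 'l::field) \<Rightarrow> bool" where
  "separable_closure \<iota> \<longleftrightarrow>
     field_embedding \<iota> \<and>
     (\<forall>x. separable_element \<iota> x) \<and>
     (\<forall>p::'l poly. Polynomial.degree p > 0 \<longrightarrow> separable_polynomial p \<longrightarrow> (\<exists>x. poly p x = 0))"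

text \<open>When \<open>\<iota>\<close> is a separable closure, \<open>'l\<close> contains every root of unity of an algebraic closure
  of \<open>'k\<close>: in characteristic \<open>p > 0\<close> these have order prime to \<open>p\<close>, hence are separable.\<close>

definition contains_all_roots_of_unity :: "('k::field \<Rightarrow> 'l::field) \<Rightarrow> bool" where
  "contains_all_roots_of_unity \<iota> \<longleftrightarrow> (\<forall>\<zeta> n. n > 0 \<longrightarrow> \<zeta> ^ n = 1 \<longrightarrow> \<zeta> \<in> range \<iota>)"

section \<open>Galois groups and the Krull topology\<close>

definition galois_group :: "('k::field \<Rightarrow> 'l::field) \<Rightarrow> ('l \<Rightarrow> 'l) monoid" where
  "galois_group \<iota> =
     \<lparr>carrier = {\<sigma>. bij \<sigma> \<and> (\<forall>x y. \<sigma> (x + y) = \<sigma> x + \<sigma> y) \<and> (\<forall>x y. \<sigma> (x * y) = \<sigma> x * \<sigma> y) \<and>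
                    (\<forall>a. \<sigma> (\<iota> a) = \<iota> a)},
      mult = (\<circ>), one = id\<rparr>"

definition finite_intermediate_field :: "('k::field \<Rightarrow> 'l::field) \<Rightarrow> 'l set \<Rightarrow> bool" where
  "finite_intermediate_field \<iota> F \<longleftrightarrow>
     subfield F ring_of_type_algebra \<and> range \<iota> \<subseteq> F \<and>
     ring.finite_dimension ring_of_type_algebra (range \<iota>) F"

definition fixing_subgroup :: "('k::field \<Rightarrow> 'l::field) \<Rightarrow> 'l set \<Rightarrow> ('l \<Rightarrow> 'l) set" where
  "fixing_subgroup \<iota> F = {\<sigma> \<in> carrier (galois_group \<iota>). \<forall>x\<in>F. \<sigma> x = x}"

definition krull_topology :: "('k::field \<Rightarrow> 'l::field) \<Rightarrow> ('l \<Rightarrow> 'l) topology" where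
  "krull_topology \<iota> = topology_generated_by
     {\<sigma> <#\<^bsub>galois_group \<iota>\<^esub> fixing_subgroup \<iota> F | \<sigma> F.
        \<sigma> \<in> carrier (galois_group \<iota>) \<and> finite_intermediate_field \<iota> F}"

end

theory Submission
  imports Defs
begin

text \<open>Let \<open>K\<close> be a closed subgroup of the Galois group and \<open>D\<close> the closure of its commutator subgroup. It has to
  be shown that \<open>x ^ n \<in> D\<close> implies \<open>x \<in> D\<close> for \<open>x \<in> K\<close>, and \<open>n\<close> may be taken to be a prime \<open>p\<close>
  (\<open>torsion_in_closure_derived\<close>).

  Cohomologically, the dual of \<open>K / D\<close> is the group of continuous characters of \<open>K\<close>, and \<open>K / D\<close> has no
  \<open>p\<close>-torsion as soon as every such character with values in a \<open>p\<close>-group is \<open>p\<close> times another one. If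
  \<open>p\<close> is not the characteristic, this is Kummer theory: all roots of unity lie in the base field, so a
  character is given by \<open>\<sigma> \<mapsto> \<sigma> a / a\<close>, and a \<open>p\<close>-th root of \<open>a\<close> gives the required character. If \<open>p\<close> is the
  characteristic, it is the vanishing of the second cohomology of \<open>K\<close> with coefficients in the prime field,
  which comes from the Artin-Schreier sequence.

  The proof makes both arguments explicit and constructs from an element \<open>x \<in> K\<close> outside \<open>D\<close> with
  \<open>x ^ p \<in> D\<close> a field element \<open>w\<close> such that \<open>K\<close> acts commutatively on \<open>w\<close> but \<open>x ^ p\<close> moves \<open>w\<close>. This is
  absurd: the commutators fix \<open>w\<close>, hence so does the closure \<open>D\<close>. In place of a character detecting \<open>x\<close> there is
  a normal subgroup \<open>V\<close> of \<open>K\<close> that contains \<open>D\<close> but not \<open>x\<close> and for which \<open>K / V\<close> is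
  cyclic of \<open>p\<close>-power order (\<open>exists_cyclic_prime_power_quotient\<close>). The Galois theory needed to work in the
  fixed field of \<open>V\<close> is that elements of \<open>K\<close> outside \<open>V\<close> act nontrivially on it
  (\<open>fixed_field_separates\<close>); this, like the existence of Lagrange resolvents and of elements of trace \<open>1\<close>,
  follows from Dedekind's independence of characters (\<open>dedekind_independence\<close>). The element \<open>w\<close> is then
  a \<open>p\<close>-th root of a resolvent (\<open>kummer_witness\<close>) or a root of an Artin-Schreier polynomial
  (\<open>artin_schreier_witness\<close>).

  On the topological side, the Krull topology is identified with that of pointwise convergence
  (\<open>openin_krull_topology_iff\<close>), from which profiniteness follows by Tychonoff's theorem and elements
  of \<open>D\<close> are exactly those that agree on each finite set with an element of the commutator subgroup.\<close>

section \<open>Cyclic quotients of prime power order\<close>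

text \<open>The hypothesis \<open>min\<close> says that every nontrivial subgroup contains \<open>x\<close>. An element of prime order
  \<open>q \<noteq> p\<close> would have a power equal to \<open>x\<close>, and \<open>x\<close> would be killed by both \<open>p\<close> and \<open>q\<close>.\<close>

lemma (in group) ord_prime_power_if_unique_minimal_subgroup:
  assumes fin: "finite (carrier G)" and p: "Factorial_Ring.prime (p::nat)"
    and x: "x \<in> carrier G" "x \<noteq> \<one>" "x [^] p = \<one>"
    and min: "\<And>a. a \<in> carrier G \<Longrightarrow> a \<noteq> \<one> \<Longrightarrow> \<exists>i::nat. x = a [^] i"
    and a: "a \<in> carrier G"
  shows "\<exists>j. ord a = p ^ j"
proof -
  have only_p: "q = p" if q: "Factorial_Ring.prime q" "q dvd ord a" for q
  proof (rule ccontr)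
    assume "q \<noteq> p"
    have pos: "ord a > 0" using ord_ge_1[OF fin a] by simp
    let ?k = "ord a div q"
    have "?k dvd ord a" "?k \<noteq> 0"
      using q pos by (metis dvd_mult_div_cancel dvd_triv_right, auto simp: dvd_imp_le div_greater_zero_iff)
    then have ord_b: "ord (a [^] ?k) = q"
      using ord_pow[OF a, of ?k] q pos
      by (metis dvd_div_eq_0_iff dvd_div_div_eq_mult nonzero_mult_div_cancel_left dvd_mult_div_cancel
          nonzero_mult_div_cancel_right)
    have "a [^] ?k \<noteq> \<one>"
      using ord_b ord_id q(1) by (metis not_prime_1)
    then obtain i :: nat where i: "x = (a [^] ?k) [^] i"
      using min[of "a [^] ?k"] a by auto
    have "x [^] q = ((a [^] ?k) [^] q) [^] i"
      unfolding i using a by (simp add: nat_pow_pow mult.commute mult.left_commute)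
    also have "\<dots> = \<one>"
      using pow_ord_eq_1[of "a [^] ?k"] a ord_b by simp
    finally have "ord x dvd q" "ord x dvd p"
      using x pow_eq_id by auto
    then have "ord x = 1"
      using p q(1) \<open>q \<noteq> p\<close> by (metis prime_nat_iff)
    then show False using x ord_eq_1 by auto
  qed
  obtain m where m: "ord a = p ^ multiplicity p (ord a) * m" "\<not> p dvd m"
    using multiplicity_decompose'[of "ord a" p] ord_ge_1[OF fin a] p
    by (metis not_one_le_zero not_prime_unit)
  have "m = 1"
    using m only_p by (metis prime_factor_nat dvd_triv_right dvd_trans)
  then show ?thesis using m(1) by auto
qed

text \<open>An element \<open>g\<close> of maximal order \<open>p ^ r\<close> generates. Elements killed by \<open>p\<close> are powers of \<open>x\<close>, hence of
  \<open>g\<close>. If \<open>a ^ p = g ^ i\<close>, then maximality forces \<open>p\<close> to divide \<open>i\<close>, so \<open>a\<close> differs from a power of \<open>g\<close> by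
  an element killed by \<open>p\<close>.\<close>

lemma (in comm_group) cyclic_if_unique_minimal_subgroup:
  assumes fin: "finite (carrier G)" and p: "Factorial_Ring.prime (p::nat)"
    and x: "x \<in> carrier G" "x \<noteq> \<one>" "x [^] p = \<one>"
    and min: "\<And>a. a \<in> carrier G \<Longrightarrow> a \<noteq> \<one> \<Longrightarrow> \<exists>i::nat. x = a [^] i"
  shows "\<exists>g\<in>carrier G. \<exists>r. ord g = p ^ r \<and> (\<forall>a\<in>carrier G. \<exists>i::nat. a = g [^] i)"
proof -
  have ppow: "\<exists>j. ord a = p ^ j" if "a \<in> carrier G" for a
    by (rule ord_prime_power_if_unique_minimal_subgroup[OF fin p x min that])
  have "finite (ord ` carrier G)" "ord ` carrier G \<noteq> {}"
    using fin x by auto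
  then have "Max (ord ` carrier G) \<in> ord ` carrier G"
    by (rule Max_in)
  then obtain g where g: "g \<in> carrier G" "ord g = Max (ord ` carrier G)"
    by auto
  have gmax: "ord a \<le> ord g" if "a \<in> carrier G" for a
    using fin that g(2) by simp
  obtain r where r: "ord g = p ^ r" using ppow g(1) by blast
  have "g \<noteq> \<one>"
    using gmax[OF x(1)] ord_ge_1[OF fin x(1)] x(1,2) ord_eq_1 by (metis le_antisym ord_id)
  then obtain j0 :: nat where j0: "x = g [^] j0" using min g(1) by blast
  have base: "\<exists>i::nat. a = g [^] i" if a: "a \<in> carrier G" "a [^] p = \<one>" for a
  proof (cases "a = \<one>")
    case True
    then show ?thesis by (metis nat_pow_0)
  next
    case False
    then obtain i :: nat where i: "x = a [^] i" using min a(1) by blast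
    have ord_a: "ord a = p"
      using a False p by (metis pow_eq_id ord_eq_1 prime_nat_iff)
    have "\<not> p dvd i"
      using i x(2) a ord_a pow_eq_id by metis
    then have "coprime i p" using p by (metis coprime_commute prime_imp_coprime)
    then obtain u v where uv: "i * u = p * v + 1"
      using coprime_bezout_strong[of i p] p by (metis not_prime_1)
    have "a = a [^] (p * v + 1)"
      using a by (simp add: nat_pow_mult[symmetric] nat_pow_pow[symmetric])
    also have "\<dots> = x [^] u"
      using a(1) i uv by (simp add: nat_pow_pow)
    also have "\<dots> = g [^] (j0 * u)"
      using g(1) j0 by (simp add: nat_pow_pow)
    finally show ?thesis by blast
  qed
  have step: "\<exists>i::nat. a = g [^] i" if a: "a \<in> carrier G" "ord a = p ^ j" for a j
    using a
  proof (induction j arbitrary: a)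
    case 0
    then show ?case by (metis nat_pow_0 ord_eq_1 power_0)
  next
    case (Suc j)
    have "ord (a [^] p) = p ^ j"
      using ord_pow[OF Suc.prems(1), of p] Suc.prems(2) p by (simp add: prime_gt_0_nat)
    then obtain i :: nat where i: "a [^] p = g [^] i"
      using Suc by (metis nat_pow_closed)
    have "p dvd i"
    proof (rule ccontr)
      assume np: "\<not> p dvd i"
      then have "coprime (p ^ r) i" using p by (simp add: prime_imp_coprime)
      then have "ord (g [^] i) = p ^ r"
        using ord_pow_gen[OF g(1), of i] r np by (auto simp: coprime_iff_gcd_eq_1)
      then have "p ^ r = p ^ j" using i \<open>ord (a [^] p) = p ^ j\<close> by simp
      then have "ord g < ord a" using Suc.prems(2) r prime_gt_1_nat[OF p] by simp
      then show False using gmax[OF Suc.prems(1)] by simp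
    qed
    then obtain i' where i': "i = i' * p" by (metis dvdE mult.commute)
    let ?c = "a \<otimes> inv (g [^] i')"
    have "?c [^] p = a [^] p \<otimes> inv (g [^] i)"
      using Suc.prems(1) g(1) by (simp add: nat_pow_distrib nat_pow_inv nat_pow_pow i')
    also have "\<dots> = \<one>" using i g(1) by simp
    finally obtain k :: nat where "?c = g [^] k"
      using base[of ?c] Suc.prems(1) g(1) by auto
    then have "a = g [^] k \<otimes> g [^] i'"
      using Suc.prems(1) g(1) by (metis inv_closed inv_solve_right nat_pow_closed inv_inv m_closed)
    then show ?case using g(1) by (metis nat_pow_mult)
  qed
  show ?thesis using g(1) r step ppow by blast
qed

lemma (in group) normal_if_derived_subset:
  assumes "subgroup V G" "derived G (carrier G) \<subseteq> V"
  shows "V \<lhd> G"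
proof -
  interpret V: subgroup V G by fact
  have "y \<otimes> h \<otimes> inv y \<in> V" if y: "y \<in> carrier G" and h: "h \<in> V" for y h
  proof -
    have "y \<otimes> h \<otimes> inv y \<otimes> inv h \<in> derived_set G (carrier G)"
      using y h V.subset by auto
    then have "y \<otimes> h \<otimes> inv y \<otimes> inv h \<in> V"
      using assms(2) unfolding derived_def by (meson generate.incl subsetD)
    then have "(y \<otimes> h \<otimes> inv y \<otimes> inv h) \<otimes> h \<in> V"
      using h by (rule V.m_closed)
    then show ?thesis
      using y h V.subset by (simp add: m_assoc)
  qed
  then show ?thesis
    using assms(1) normal_inv_iff by blast
qed

lemma (in group) comm_group_Mod_if_derived_subset:
  assumes "subgroup V G" "derived G (carrier G) \<subseteq> V"
  shows "comm_group (G Mod V)"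
proof -
  interpret V: normal V G using assms by (rule normal_if_derived_subset)
  have "V #> (a \<otimes> b) = V #> (b \<otimes> a)" if a: "a \<in> carrier G" and b: "b \<in> carrier G" for a b
  proof -
    have "a \<otimes> b \<otimes> inv a \<otimes> inv b \<in> derived_set G (carrier G)"
      using a b by auto
    then have "a \<otimes> b \<otimes> inv a \<otimes> inv b \<in> V"
      using assms(2) unfolding derived_def by (meson generate.incl subsetD)
    then have "V #> ((a \<otimes> b \<otimes> inv a \<otimes> inv b) \<otimes> (b \<otimes> a)) = V #> (b \<otimes> a)"
      using a b V.subset by (metis coset_mult_assoc m_closed V.rcos_const group_axioms inv_closed)
    moreover have "(a \<otimes> b \<otimes> inv a \<otimes> inv b) \<otimes> (b \<otimes> a) = a \<otimes> b"
      using a b by (simp add: m_assoc) (metis inv_closed l_inv m_assoc m_closed r_one l_one)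
    ultimately show ?thesis by simp
  qed
  then show ?thesis
    by (intro group.group_comm_groupI V.factorgroup_is_group)
       (auto simp: carrier_FactGroup V.rcos_sum)
qed

text \<open>Take \<open>V\<close> maximal among the subgroups that contain \<open>N\<close> but not \<open>x\<close>: then every nontrivial subgroup of
  the finite abelian group \<open>G Mod V\<close> contains the class of \<open>x\<close>. This does the work of a character of
  \<open>G / N\<close> that is nontrivial on \<open>x\<close> and takes values in a cyclic \<open>p\<close>-group.\<close>

lemma (in group) exists_cyclic_prime_power_quotient:
  assumes N: "subgroup N G" "derived G (carrier G) \<subseteq> N" "finite (rcosets N)"
    and p: "Factorial_Ring.prime (p::nat)"
    and x: "x \<in> carrier G" "x \<notin> N" "x [^] p \<in> N"
  shows "\<exists>V g r. V \<lhd> G \<and> N \<subseteq> V \<and> x \<notin> V \<and> g \<in> carrier G \<and>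
    (\<forall>a\<in>carrier G. \<exists>i::nat. \<exists>v\<in>V. a = v \<otimes> g [^] i) \<and> (\<forall>i::nat. g [^] i \<in> V \<longleftrightarrow> p ^ r dvd i)"
proof -
  define \<V> where "\<V> = {V. subgroup V G \<and> N \<subseteq> V \<and> x \<notin> V}"
  \<comment> \<open>A subgroup containing \<open>N\<close> is the union of the cosets it contains, so there are finitely many.\<close>
  have "inj_on (\<lambda>V. (\<lambda>v. N #> v) ` V) \<V>"
  proof (rule inj_onI)
    have *: "V = \<Union>((\<lambda>v. N #> v) ` V)" if "V \<in> \<V>" for V
    proof -
      have sV: "subgroup V G" "N \<subseteq> V" using that unfolding \<V>_def by auto
      have "N #> v \<subseteq> V" if "v \<in> V" for v
        using subgroup.m_closed[OF sV(1)] sV(2) that by (auto simp: r_coset_def)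
      moreover have "v \<in> N #> v" if "v \<in> V" for v
        using rcos_self[OF _ N(1)] subgroup.mem_carrier[OF sV(1) that] by blast
      ultimately show ?thesis by blast
    qed
    fix V W assume "V \<in> \<V>" "W \<in> \<V>" "(\<lambda>v. N #> v) ` V = (\<lambda>v. N #> v) ` W"
    then show "V = W" using * by metis
  qed
  moreover have "(\<lambda>V. (\<lambda>v. N #> v) ` V) ` \<V> \<subseteq> Pow (rcosets N)"
    unfolding \<V>_def RCOSETS_def by (auto dest: subgroup.mem_carrier)
  ultimately have "finite \<V>"
    using N(3) by (meson finite_Pow_iff finite_imageD finite_subset)
  moreover have "N \<in> \<V>" unfolding \<V>_def using N x by auto
  ultimately obtain V where V: "V \<in> \<V>" and Vmax: "\<And>W. W \<in> \<V> \<Longrightarrow> V \<subseteq> W \<Longrightarrow> V = W"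
    using finite_has_maximal[of \<V>] by blast
  have sV: "subgroup V G" and NV: "N \<subseteq> V" and xV: "x \<notin> V"
    using V unfolding \<V>_def by auto
  have dV: "derived G (carrier G) \<subseteq> V" using N(2) NV by blast
  interpret V: normal V G using sV dV by (rule normal_if_derived_subset)
  let ?B = "G Mod V"
  interpret B: comm_group ?B using sV dV by (rule comm_group_Mod_if_derived_subset)
  have in_V: "V #> a = \<one>\<^bsub>?B\<^esub> \<longleftrightarrow> a \<in> V" if "a \<in> carrier G" for a
    using that V.rcos_const[OF group_axioms] coset_join1[OF _ that sV] by auto
  have carr: "V #> a \<in> carrier ?B" if "a \<in> carrier G" for a
    using that by (auto simp: carrier_FactGroup)
  have finB: "finite (carrier ?B)"
  proof -
    have "V #> a = V <#> (N #> a)" if "a \<in> carrier G" for a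
    proof -
      have "V <#> N = V"
      proof
        show "V <#> N \<subseteq> V" using NV V.m_closed by (auto simp: set_mult_def)
        show "V \<subseteq> V <#> N"
        proof
          fix v assume "v \<in> V"
          then have "v = v \<otimes> \<one>" using V.subset by auto
          then show "v \<in> V <#> N"
            using \<open>v \<in> V\<close> subgroup.one_closed[OF N(1)] unfolding set_mult_def by blast
        qed
      qed
      then show ?thesis
        using setmult_rcos_assoc[OF V.subset subgroup.subset[OF N(1)] that] by simp
    qed
    then have "carrier ?B \<subseteq> (\<lambda>C. V <#> C) ` (rcosets N)"
      by (auto simp: carrier_FactGroup RCOSETS_def)
    then show ?thesis using N(3) finite_surj by blast
  qed
  have min: "\<exists>i::nat. V #> x = A [^]\<^bsub>?B\<^esub> i" if A: "A \<in> carrier ?B" "A \<noteq> \<one>\<^bsub>?B\<^esub>" for A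
  proof -
    obtain a where a: "a \<in> carrier G" "A = V #> a" using A(1) by (auto simp: carrier_FactGroup)
    let ?H = "generate ?B {A}" and ?W = "{y \<in> carrier G. V #> y \<in> generate ?B {A}}"
    have H: "subgroup ?H ?B" using A by (intro B.generate_is_subgroup) auto
    have "subgroup ?W G"
      using V.factgroup_subgroup_union_subgroup[OF H] V.factgroup_subgroup_union_char[OF H] by simp
    moreover have "V \<subseteq> ?W"
    proof
      fix v assume "v \<in> V"
      then show "v \<in> ?W"
        using V.rcos_const[OF group_axioms, of v] V.subset subgroup.one_closed[OF H] by auto
    qed
    moreover have "a \<in> ?W" "a \<notin> V"
      using a A in_V by (auto intro: generate.incl)
    ultimately have "x \<in> ?W"
      using Vmax[of ?W] NV unfolding \<V>_def by blast
    then show ?thesis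
      using B.generate_pow_on_finite_carrier[OF finB A(1)] by auto
  qed
  have "V #> x \<noteq> \<one>\<^bsub>?B\<^esub>" using in_V x xV by blast
  moreover have "(V #> x) [^]\<^bsub>?B\<^esub> p = \<one>\<^bsub>?B\<^esub>"
    using V.FactGroup_pow[OF x(1)] in_V x NV by auto
  ultimately obtain C r where C: "C \<in> carrier ?B" "B.ord C = p ^ r"
      "\<forall>A\<in>carrier ?B. \<exists>i::nat. A = C [^]\<^bsub>?B\<^esub> i"
    using B.cyclic_if_unique_minimal_subgroup[OF finB p carr[OF x(1)] _ _ min] by blast
  obtain g where g: "g \<in> carrier G" "C = V #> g" using C(1) by (auto simp: carrier_FactGroup)
  have "\<exists>i::nat. \<exists>v\<in>V. a = v \<otimes> g [^] i" if a: "a \<in> carrier G" for a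
  proof -
    obtain i :: nat where "V #> a = V #> (g [^] i)"
      using C(3) carr[OF a] V.FactGroup_pow[OF g(1)] g(2) by metis
    then have "a \<in> V #> (g [^] i)" using rcos_self[OF a sV] by simp
    then show ?thesis by (auto simp: r_coset_def)
  qed
  moreover have "g [^] i \<in> V \<longleftrightarrow> p ^ r dvd i" for i :: nat
    using B.pow_eq_id[OF C(1)] V.FactGroup_pow[OF g(1)] g in_V[of "g [^] i"] C(2) by simp
  ultimately show ?thesis
    using NV xV g(1) V.normal_axioms by blast
qed

section \<open>Independence of characters and roots in separably closed fields\<close>

text \<open>Dedekind: a relation between distinct characters of a multiplicatively closed set can be shortened.
  Comparing it at \<open>y * x\<close> with \<open>\<phi> j y\<close> times itself at \<open>x\<close> eliminates the index \<open>j\<close>.\<close>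

lemma dedekind_independence:
  fixes \<phi> :: "'i \<Rightarrow> 'a::times \<Rightarrow> 'b::field"
  assumes "finite I"
    and closed: "\<And>x y. x \<in> M \<Longrightarrow> y \<in> M \<Longrightarrow> x * y \<in> M"
    and "\<And>i x y. i \<in> I \<Longrightarrow> x \<in> M \<Longrightarrow> y \<in> M \<Longrightarrow> \<phi> i (x * y) = \<phi> i x * \<phi> i y"
    and "\<And>i. i \<in> I \<Longrightarrow> \<exists>x\<in>M. \<phi> i x \<noteq> 0"
    and "\<And>i j. i \<in> I \<Longrightarrow> j \<in> I \<Longrightarrow> i \<noteq> j \<Longrightarrow> \<exists>x\<in>M. \<phi> i x \<noteq> \<phi> j x"
    and "\<And>x. x \<in> M \<Longrightarrow> (\<Sum>i\<in>I. c i * \<phi> i x) = 0"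
  shows "\<forall>i\<in>I. c i = 0"
  using assms(1,3-)
proof (induction I arbitrary: c rule: finite_induct)
  case empty
  then show ?case by simp
next
  case (insert j J)
  have J0: "\<forall>i\<in>J. c i * (\<phi> i y - \<phi> j y) = 0" if y: "y \<in> M" for y
  proof (rule insert.IH)
    fix x assume x: "x \<in> M"
    have "c j * \<phi> j (y * x) + (\<Sum>i\<in>J. c i * \<phi> i (y * x)) = 0"
      using insert.prems(4)[OF closed[OF y x]] insert.hyps by simp
    moreover have "(\<Sum>i\<in>J. c i * \<phi> i (y * x)) = (\<Sum>i\<in>J. c i * \<phi> i y * \<phi> i x)"
      using insert.prems(1) x y by (intro sum.cong) (auto simp: mult.assoc)
    moreover have "\<phi> j (y * x) = \<phi> j y * \<phi> j x"
      using insert.prems(1) x y by auto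
    moreover have "c j * \<phi> j x + (\<Sum>i\<in>J. c i * \<phi> i x) = 0"
      using insert.prems(4)[OF x] insert.hyps by simp
    then have "\<phi> j y * (c j * \<phi> j x) + (\<Sum>i\<in>J. \<phi> j y * (c i * \<phi> i x)) = 0"
      by (metis distrib_left mult_zero_right sum_distrib_left)
    ultimately show "(\<Sum>i\<in>J. (c i * (\<phi> i y - \<phi> j y)) * \<phi> i x) = 0"
      by (simp add: algebra_simps sum_subtractf) (metis add_left_cancel)
  qed (use insert.prems in auto)
  have J: "c i = 0" if i: "i \<in> J" for i
  proof -
    obtain y where "y \<in> M" "\<phi> i y \<noteq> \<phi> j y"
      using insert.prems(3)[of i j] i insert.hyps by auto
    then show ?thesis using J0[of y] i by auto
  qed
  obtain x where "x \<in> M" "\<phi> j x \<noteq> 0" using insert.prems(2) by auto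
  then have "c j = 0"
    using insert.prems(4)[of x] insert.hyps J by simp
  then show ?case using J by auto
qed

lemma degree_monom_minus:
  fixes q :: "'a::field poly"
  assumes "Polynomial.degree q < n"
  shows "Polynomial.degree (Polynomial.monom 1 n - q) = n"
  using degree_add_eq_left[of "- q" "Polynomial.monom 1 n"] assms by (simp add: degree_monom_eq)

lemma separable_polynomialI_power:
  fixes c :: "'a::field"
  assumes "n > 0" "of_nat n \<noteq> (0::'a)" "c \<noteq> 0"
  shows "separable_polynomial (Polynomial.monom 1 n - [:c:])"
proof -
  let ?f = "Polynomial.monom 1 n - [:c:]"
  have d: "pderiv ?f = Polynomial.monom (of_nat n) (n - 1)"
    by (simp add: pderiv_diff pderiv_monom pderiv_pCons)
  have "is_unit q" if q: "q dvd ?f" "q dvd pderiv ?f" for q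
  proof -
    have "q dvd [:0, inverse (of_nat n):] * pderiv ?f" using q(2) by (rule dvd_mult)
    also have "[:0, inverse (of_nat n):] * pderiv ?f = Polynomial.monom 1 n"
      unfolding d using assms by (cases n) (simp_all add: monom_Suc smult_monom)
    finally have "q dvd Polynomial.monom 1 n - ?f" using q(1) by (rule dvd_diff)
    then have "q dvd [:c:]" by simp
    moreover have "is_unit [:c:]" using assms(3) by (simp add: is_unit_const_poly_iff dvd_field_iff)
    ultimately show ?thesis by (rule dvd_unit_imp_unit)
  qed
  then show ?thesis unfolding separable_polynomial_def by (intro coprimeI)
qed

lemma separable_polynomial_factor:
  fixes f q :: "'a::field poly"
  assumes "separable_polynomial (f * q)"
  shows "separable_polynomial q"
  unfolding separable_polynomial_def
proof (rule coprimeI)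
  fix d assume d: "d dvd q" "d dvd pderiv q"
  then have "d dvd f * q" "d dvd pderiv (f * q)" by (auto simp: pderiv_mult)
  with assms show "is_unit d" unfolding separable_polynomial_def by (rule coprime_common_divisor)
qed

lemma separable_polynomialI_artin_schreier:
  fixes y :: "'a::field"
  assumes "of_nat n = (0::'a)"
  shows "separable_polynomial (Polynomial.monom 1 n - [:y, 1:])"
proof -
  have "pderiv (Polynomial.monom 1 n - [:y, 1:]) = - 1"
    using assms by (simp add: pderiv_diff pderiv_monom pderiv_pCons one_pCons)
  then show ?thesis unfolding separable_polynomial_def by (intro is_unit_right_imp_coprime) simp
qed

lemma separable_closure_exists_root_of_power:
  fixes \<iota> :: "'k::field \<Rightarrow> 'l::field"
  assumes "separable_closure \<iota>" "n > 0" "of_nat n \<noteq> (0::'l)"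
  shows "\<exists>b. b ^ n = (c::'l)"
proof (cases "c = 0")
  case True
  then show ?thesis using assms(2) by (intro exI[of _ 0]) simp
next
  case False
  have "Polynomial.degree (Polynomial.monom 1 n - [:c:]) = n"
    using assms(2) by (intro degree_monom_minus) simp
  then obtain b where "poly (Polynomial.monom 1 n - [:c:]) b = 0"
    using assms separable_polynomialI_power[OF assms(2,3) False] unfolding separable_closure_def by metis
  then show ?thesis by (auto simp: poly_monom)
qed

lemma separable_closure_exists_artin_schreier_root:
  fixes \<iota> :: "'k::field \<Rightarrow> 'l::field"
  assumes "separable_closure \<iota>" "n > 1" "of_nat n = (0::'l)"
  shows "\<exists>z. z ^ n - z = (y::'l)"
proof -
  have "Polynomial.degree (Polynomial.monom 1 n - [:y, 1:]) = n"
    using assms(2) by (intro degree_monom_minus) simp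
  then obtain z where "poly (Polynomial.monom 1 n - [:y, 1:]) z = 0"
    using assms separable_polynomialI_artin_schreier[OF assms(3)] unfolding separable_closure_def
    by (metis less_trans zero_less_one)
  then have "z ^ n - z = y" by (simp add: poly_monom algebra_simps)
  then show ?thesis ..
qed

text \<open>A root of the cofactor of \<open>X - 1\<close> in \<open>X ^ n - 1\<close> works: it is not \<open>1\<close>, because \<open>1\<close> is a simple root of
  \<open>X ^ n - 1\<close> when \<open>n\<close> is invertible.\<close>

lemma separable_closure_exists_nontrivial_root_of_unity:
  fixes \<iota> :: "'k::field \<Rightarrow> 'l::field"
  assumes "separable_closure \<iota>" "n > 1" "of_nat n \<noteq> (0::'l)"
  shows "\<exists>\<zeta>::'l. \<zeta> ^ n = 1 \<and> \<zeta> \<noteq> 1"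
proof -
  let ?f = "Polynomial.monom 1 n - [:1::'l:]"
  have "poly ?f 1 = 0" by (simp add: poly_monom)
  then obtain q where q: "?f = [:-1, 1:] * q" by (metis poly_eq_0_iff_dvd dvdE)
  have deg: "Polynomial.degree ?f = n"
    using assms(2) by (intro degree_monom_minus) simp
  have sep: "separable_polynomial ?f"
    using assms by (intro separable_polynomialI_power) auto
  have "q \<noteq> 0" using q deg assms(2) by auto
  then have "Polynomial.degree ?f = 1 + Polynomial.degree q" unfolding q by (subst degree_mult_eq) auto
  then have "Polynomial.degree q > 0" using deg assms(2) by simp
  moreover have "separable_polynomial q" using sep unfolding q by (rule separable_polynomial_factor)
  ultimately obtain \<zeta> where \<zeta>: "poly q \<zeta> = 0" using assms(1) unfolding separable_closure_def by blast
  have "poly ?f \<zeta> = 0" unfolding q using \<zeta> by simp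
  then have "\<zeta> ^ n = 1" by (simp add: poly_monom)
  moreover have "\<zeta> \<noteq> 1"
  proof
    assume "\<zeta> = 1"
    have "poly (pderiv ?f) 1 = poly q 1 + poly (pderiv q) 1 * poly [:-1,1:] 1"
      unfolding q pderiv_mult by (simp add: pderiv_pCons)
    then have "poly (pderiv ?f) 1 = 0" using \<zeta> \<open>\<zeta> = 1\<close> by simp
    moreover have "poly (pderiv ?f) 1 = of_nat n"
      by (simp add: pderiv_diff pderiv_monom pderiv_pCons poly_monom)
    ultimately show False using assms(3) by simp
  qed
  ultimately show ?thesis by blast
qed

text \<open>If \<open>\<zeta>\<close> is a nontrivial \<open>p\<close>-th root of unity and \<open>r > 0\<close>, then any solution of
  \<open>\<omega> ^ (p ^ (r - 1)) = \<zeta>\<close> has exact order \<open>p ^ r\<close>.\<close>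

lemma separable_closure_exists_primitive_root_of_unity:
  fixes \<iota> :: "'k::field \<Rightarrow> 'l::field"
  assumes sc: "separable_closure \<iota>" and p: "Factorial_Ring.prime p" "of_nat p \<noteq> (0::'l)"
  shows "\<exists>\<omega>::'l. \<omega> \<noteq> 0 \<and> (\<forall>i. \<omega> ^ i = 1 \<longleftrightarrow> p ^ r dvd i)"
proof (cases r)
  case 0
  then show ?thesis by (intro exI[of _ 1]) simp
next
  case (Suc s)
  have p1: "p > 1" using p(1) by (rule prime_gt_1_nat)
  obtain \<zeta> :: 'l where \<zeta>: "\<zeta> ^ p = 1" "\<zeta> \<noteq> 1"
    using separable_closure_exists_nontrivial_root_of_unity[OF sc p1 p(2)] by blast
  have "of_nat (p ^ s) \<noteq> (0::'l)" using p(2) by simp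
  then obtain \<omega> where \<omega>: "\<omega> ^ (p ^ s) = \<zeta>"
    using separable_closure_exists_root_of_power[OF sc, of "p ^ s" \<zeta>] p1 by auto
  have one: "\<omega> ^ (p ^ r) = 1" using \<omega> \<zeta>(1) Suc by (simp add: power_mult mult.commute[of p])
  then have "\<omega> \<noteq> 0" using p1 by (metis power_0_left zero_neq_one power_eq_0_iff not_one_less_zero)
  moreover have "p ^ r dvd i" if i: "\<omega> ^ i = 1" for i
  proof (rule ccontr)
    assume ndvd: "\<not> p ^ r dvd i"
    have "i \<noteq> 0" using ndvd by (intro notI) simp
    then obtain u v where uv: "i * u = p ^ r * v + gcd i (p ^ r)" using bezout_nat by blast
    have "1 = \<omega> ^ (i * u)" using i by (simp add: power_mult)
    also have "\<dots> = \<omega> ^ gcd i (p ^ r)" unfolding uv using one by (simp add: power_add power_mult)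
    finally have g: "\<omega> ^ gcd i (p ^ r) = 1" by simp
    obtain t where t: "t \<le> r" "gcd i (p ^ r) = p ^ t"
      using divides_primepow_nat[OF p(1)] gcd_dvd2[of i "p ^ r"] by blast
    have "t \<noteq> r" using t(2) ndvd by (metis gcd_dvd1)
    then have "p ^ t dvd p ^ s" using t(1) Suc by (intro le_imp_power_dvd) simp
    then have "\<omega> ^ (p ^ s) = 1" using g t(2) by (metis dvdE power_mult power_one)
    then show False using \<omega> \<zeta>(2) by simp
  qed
  ultimately show ?thesis using one by (metis dvdE power_mult power_one)
qed

section \<open>Elements of the Galois group\<close>

lemma galois_group_simps [simp]:
  "\<sigma> \<otimes>\<^bsub>galois_group \<iota>\<^esub> \<tau> = \<sigma> \<circ> \<tau>" "\<one>\<^bsub>galois_group \<iota>\<^esub> = id"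
  by (simp_all add: galois_group_def)

lemma galois_group_mem:
  "\<sigma> \<in> carrier (galois_group \<iota>) \<longleftrightarrow> bij \<sigma> \<and> (\<forall>x y. \<sigma> (x + y) = \<sigma> x + \<sigma> y) \<and>
    (\<forall>x y. \<sigma> (x * y) = \<sigma> x * \<sigma> y) \<and> (\<forall>a. \<sigma> (\<iota> a) = \<iota> a)"
  by (simp add: galois_group_def)

locale galois_automorphism =
  fixes \<iota> :: "'k::field \<Rightarrow> 'l::field" and \<sigma> :: "'l \<Rightarrow> 'l"
  assumes mem: "\<sigma> \<in> carrier (galois_group \<iota>)"
begin

lemma bij: "bij \<sigma>" and inj: "inj \<sigma>"
  using mem by (auto simp: galois_group_mem bij_def)

lemma add [simp]: "\<sigma> (x + y) = \<sigma> x + \<sigma> y"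
  and mult [simp]: "\<sigma> (x * y) = \<sigma> x * \<sigma> y"
  and fixes_base: "a \<in> range \<iota> \<Longrightarrow> \<sigma> a = a"
  using mem by (auto simp: galois_group_mem)

lemma zero [simp]: "\<sigma> 0 = 0" by (metis add add_cancel_right_left)
lemma eq_0_iff [simp]: "\<sigma> x = 0 \<longleftrightarrow> x = 0" using inj zero by (metis injD)
lemma one [simp]: "\<sigma> 1 = 1" using mult[of 1 1] by (simp add: field_simps) 
lemma minus [simp]: "\<sigma> (- x) = - \<sigma> x" using add[of x "- x"] by (simp add: eq_neg_iff_add_eq_0 add.commute)
lemma diff [simp]: "\<sigma> (x - y) = \<sigma> x - \<sigma> y" using add[of x "- y"] by simp
lemma power [simp]: "\<sigma> (x ^ n) = \<sigma> x ^ n" by (induction n) simp_all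
lemma inverse [simp]: "\<sigma> (inverse x) = inverse (\<sigma> x)"
proof (cases "x = 0")
  case False
  then have "\<sigma> x * \<sigma> (inverse x) = 1" using mult[of x "inverse x"] by simp
  then show ?thesis by (metis inverse_unique)
qed simp
lemma divide [simp]: "\<sigma> (x / y) = \<sigma> x / \<sigma> y" by (simp add: divide_inverse)
lemma sum [simp]: "\<sigma> (\<Sum>i\<in>I. f i) = (\<Sum>i\<in>I. \<sigma> (f i))"
  by (induction I rule: infinite_finite_induct) simp_all
lemma of_nat [simp]: "\<sigma> (of_nat n) = of_nat n" by (induction n) simp_all
lemma poly_map_poly:
  assumes "\<iota> 0 = 0"
  shows "\<sigma> (poly (map_poly \<iota> p) x) = poly (map_poly \<iota> p) (\<sigma> x)"
  by (induction p) (simp_all add: map_poly_pCons assms fixes_base)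

end

lemma group_galois_group: "group (galois_group (\<iota> :: 'k::field \<Rightarrow> 'l::field))"
proof (rule groupI)
  fix \<sigma> assume s: "\<sigma> \<in> carrier (galois_group \<iota>)"
  interpret galois_automorphism \<iota> \<sigma> using s by unfold_locales
  have 1: "inv_into UNIV \<sigma> \<circ> \<sigma> = id" using inj by simp
  have 2: "\<sigma> (inv_into UNIV \<sigma> x) = x" for x using bij by (simp add: bij_is_surj surj_f_inv_f)
  have "inv_into UNIV \<sigma> \<in> carrier (galois_group \<iota>)"
    unfolding galois_group_mem
  proof (intro conjI allI)
    show "inv_into UNIV \<sigma> (x + y) = inv_into UNIV \<sigma> x + inv_into UNIV \<sigma> y" for x y by (metis 2 add inj inv_f_f)
    show "inv_into UNIV \<sigma> (x * y) = inv_into UNIV \<sigma> x * inv_into UNIV \<sigma> y" for x y by (metis 2 mult inj inv_f_f)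
    show "inv_into UNIV \<sigma> (\<iota> a) = \<iota> a" for a by (metis fixes_base rangeI inj inv_f_f)
  qed (use bij in \<open>simp add: bij_imp_bij_inv\<close>)
  then show "\<exists>\<tau>\<in>carrier (galois_group \<iota>). \<tau> \<otimes>\<^bsub>galois_group \<iota>\<^esub> \<sigma> = \<one>\<^bsub>galois_group \<iota>\<^esub>"
    using 1 by auto
qed (auto simp: galois_group_mem bij_comp o_assoc)

lemma galois_group_inv:
  assumes "\<sigma> \<in> carrier (galois_group \<iota>)"
  shows "inv\<^bsub>galois_group \<iota>\<^esub> \<sigma> = inv_into UNIV \<sigma>"
proof -
  interpret group "galois_group \<iota>" by (rule group_galois_group)
  have "inv\<^bsub>galois_group \<iota>\<^esub> \<sigma> \<circ> \<sigma> = id" using l_inv[OF assms] by simp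
  moreover have "bij \<sigma>" using assms by (simp add: galois_group_mem)
  ultimately show ?thesis by (metis bij_is_surj comp_assoc comp_id id_comp surj_iff)
qed

lemma galois_group_pow:
  "\<sigma> [^]\<^bsub>(galois_group \<iota>)\<lparr>carrier := K\<rparr>\<^esub> (n::nat) = \<sigma> ^^ n"
proof (induction n)
  case 0
  then show ?case by (simp add: nat_pow_def)
next
  case (Suc n)
  then show ?case by (simp add: nat_pow_def funpow_swap1 fun_eq_iff)
qed

section \<open>Separating a subgroup by its fixed field\<close>

lemma galois_subgroup_closed:
  assumes "subgroup K (galois_group \<iota>)"
  shows "id \<in> K" "\<sigma> \<in> K \<Longrightarrow> \<tau> \<in> K \<Longrightarrow> \<sigma> \<circ> \<tau> \<in> K" "\<sigma> \<in> K \<Longrightarrow> inv_into UNIV \<sigma> \<in> K"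
    "\<sigma> \<in> K \<Longrightarrow> \<sigma> ^^ n \<in> K" "\<sigma> \<in> K \<Longrightarrow> \<sigma> \<in> carrier (galois_group \<iota>)"
proof -
  interpret subgroup K "galois_group \<iota>" by fact
  show 1: "id \<in> K" "\<sigma> \<in> K \<Longrightarrow> \<tau> \<in> K \<Longrightarrow> \<sigma> \<circ> \<tau> \<in> K" for \<sigma> \<tau>
    using one_closed m_closed[of \<sigma> \<tau>] by auto
  show 2: "\<sigma> \<in> K \<Longrightarrow> \<sigma> \<in> carrier (galois_group \<iota>)" by (rule mem_carrier)
  show "\<sigma> \<in> K \<Longrightarrow> inv_into UNIV \<sigma> \<in> K" using m_inv_closed[of \<sigma>] galois_group_inv[OF 2] by auto
  show "\<sigma> \<in> K \<Longrightarrow> \<sigma> ^^ n \<in> K" by (induction n) (auto simp: 1)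
qed

text \<open>The half of the Galois correspondence that is needed: an element of \<open>K\<close> fixing the fixed field of
  \<open>V\<close> lies in \<open>V\<close>, if \<open>V\<close> contains the pointwise stabiliser of a finite stable set \<open>S\<close>. Let \<open>E\<close> consist of
  the elements fixed by that stabiliser; on \<open>E\<close> the group \<open>V\<close> acts through a finite set \<open>R\<close> of maps. For
  \<open>u \<in> E\<close> the trace, i.e. the sum of \<open>f u\<close> over \<open>f \<in> R\<close>, is fixed by \<open>V\<close>. If \<open>\<sigma>\<close> fixed all these traces
  without lying in \<open>V\<close>, the maps in \<open>R\<close> and their composites with \<open>\<sigma>\<close> would be distinct characters of \<open>E\<close>
  satisfying a linear relation.\<close>

lemma fixed_field_separates:
  fixes \<iota> :: "'k::field \<Rightarrow> 'l::field"
  assumes K: "subgroup K (galois_group \<iota>)" and V: "subgroup V (galois_group \<iota>)" "V \<subseteq> K"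
    and S: "finite S" "\<And>\<tau> s. \<tau> \<in> K \<Longrightarrow> s \<in> S \<Longrightarrow> \<tau> s \<in> S"
    and fix_S: "\<And>\<tau>. \<tau> \<in> K \<Longrightarrow> \<forall>s\<in>S. \<tau> s = s \<Longrightarrow> \<tau> \<in> V"
    and \<sigma>: "\<sigma> \<in> K" "\<sigma> \<notin> V"
  shows "\<exists>y. (\<forall>v\<in>V. v y = y) \<and> \<sigma> y \<noteq> y"
proof (rule ccontr)
  assume contra: "\<not> ?thesis"
  note Kc = galois_subgroup_closed[OF K] and Vc = galois_subgroup_closed[OF V(1)]
  have aut: "galois_automorphism \<iota> \<tau>" if "\<tau> \<in> K" for \<tau>
    using Kc(5)[OF that] by unfold_locales
  have cancel: "inv_into UNIV \<tau> (\<tau> y) = y" "\<tau> (inv_into UNIV \<tau> y) = y" if "\<tau> \<in> K" for \<tau> y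
    using galois_automorphism.bij[OF aut[OF that]] by (simp_all add: bij_is_inj bij_is_surj surj_f_inv_f)
  define E where "E = {e. \<forall>\<tau>\<in>K. (\<forall>s\<in>S. \<tau> s = s) \<longrightarrow> \<tau> e = e}"
  have SE: "S \<subseteq> E" unfolding E_def by auto
  have E1: "1 \<in> E" unfolding E_def using galois_automorphism.one[OF aut] by auto
  have Emult: "x * y \<in> E" if "x \<in> E" "y \<in> E" for x y
    using that unfolding E_def by (auto simp: galois_automorphism.mult[OF aut])
  have agree: "\<tau> e = \<tau>' e" if "\<tau> \<in> K" "\<tau>' \<in> K" "\<forall>s\<in>S. \<tau> s = \<tau>' s" "e \<in> E" for \<tau> \<tau>' e
  proof -
    have "inv_into UNIV \<tau>' \<circ> \<tau> \<in> K" by (intro Kc(2) Kc(3) that)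
    moreover have "\<forall>s\<in>S. (inv_into UNIV \<tau>' \<circ> \<tau>) s = s" using that cancel by simp
    ultimately have "(inv_into UNIV \<tau>' \<circ> \<tau>) e = e" using that(4) unfolding E_def by blast
    then show ?thesis using cancel(2)[OF that(2), of "\<tau> e"] by simp
  qed
  define R where "R = (\<lambda>\<tau>. restrict \<tau> E) ` V"
  define R' where "R' = (\<lambda>f. restrict (\<sigma> \<circ> f) E) ` R"
  have finR: "finite R"
  proof (rule finite_imageD)
    have "(\<lambda>f. restrict f S) ` R \<subseteq> S \<rightarrow>\<^sub>E S"
    proof
      fix h assume "h \<in> (\<lambda>f. restrict f S) ` R"
      then obtain \<tau> where "\<tau> \<in> V" "h = restrict (restrict \<tau> E) S" unfolding R_def by blast
      then show "h \<in> S \<rightarrow>\<^sub>E S" using SE S(2)[of \<tau>] V(2) by (auto simp: subset_eq)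
    qed
    then show "finite ((\<lambda>f. restrict f S) ` R)"
      using S(1) by (meson finite_PiE finite_subset)
    show "inj_on (\<lambda>f. restrict f S) R"
    proof (rule inj_onI)
      fix f h assume "f \<in> R" "h \<in> R" and eq: "restrict f S = restrict h S"
      then obtain \<tau> \<tau>' where t: "\<tau> \<in> V" "\<tau>' \<in> V" "f = restrict \<tau> E" "h = restrict \<tau>' E"
        unfolding R_def by auto
      have "\<forall>s\<in>S. \<tau> s = \<tau>' s"
        using eq SE t by (metis restrict_apply' subsetD)
      then have "\<tau> e = \<tau>' e" if "e \<in> E" for e using agree[of \<tau> \<tau>' e] t V(2) that by auto
      then show "f = h" unfolding t(3,4) by (rule restrict_ext)
    qed
  qed
  have in_R: "restrict (\<tau> \<circ> f) E \<in> R" if "\<tau> \<in> V" "f \<in> R" for \<tau> f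
  proof -
    obtain \<rho> where "\<rho> \<in> V" "f = restrict \<rho> E" using \<open>f \<in> R\<close> unfolding R_def by auto
    then have "restrict (\<tau> \<circ> f) E = restrict (\<tau> \<circ> \<rho>) E" "\<tau> \<circ> \<rho> \<in> V"
      using Vc(2)[OF that(1), of \<rho>] by (auto simp: fun_eq_iff restrict_def)
    then show ?thesis unfolding R_def by blast
  qed
  have ext: "f \<in> extensional E" if "f \<in> R \<union> R'" for f
    using that unfolding R_def R'_def by auto
  have injR: "inj_on (\<lambda>f. restrict (\<tau> \<circ> f) E) R" if "\<tau> \<in> K" for \<tau>
  proof (rule inj_onI)
    fix f h assume fh: "f \<in> R" "h \<in> R" "restrict (\<tau> \<circ> f) E = restrict (\<tau> \<circ> h) E"
    show "f = h"
    proof (rule extensionalityI[of _ E])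
      fix e assume "e \<in> E"
      then have "\<tau> (f e) = \<tau> (h e)" using fh(3) by (metis comp_apply restrict_apply')
      then show "f e = h e" using cancel(1)[OF that] by metis
    qed (use fh ext in auto)
  qed
  have disj: "R \<inter> R' = {}"
  proof (rule ccontr)
    assume "R \<inter> R' \<noteq> {}"
    then obtain \<tau> \<tau>' where t: "\<tau> \<in> V" "\<tau>' \<in> V" "restrict \<tau>' E = restrict (\<sigma> \<circ> restrict \<tau> E) E"
      unfolding R_def R'_def by auto
    have eq: "\<tau>' e = \<sigma> (\<tau> e)" if "e \<in> E" for e
      using fun_cong[OF t(3), of e] that by simp
    let ?\<rho> = "inv_into UNIV \<tau>' \<circ> (\<sigma> \<circ> \<tau>)"
    have tK: "\<tau> \<in> K" "\<tau>' \<in> K" using t V(2) by auto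
    have "\<forall>s\<in>S. ?\<rho> s = s" using eq SE cancel(1)[OF tK(2)] by (metis comp_apply subsetD)
    moreover have \<rho>K: "?\<rho> \<in> K"
      by (intro Kc(2) Kc(3) tK \<sigma>(1))
    ultimately have "?\<rho> \<in> V" by (rule fix_S[rotated])
    then have "(\<tau>' \<circ> ?\<rho>) \<circ> inv_into UNIV \<tau> \<in> V" by (rule Vc(2)[OF Vc(2)[OF t(2)] Vc(3)[OF t(1)]])
    also have "(\<tau>' \<circ> ?\<rho>) \<circ> inv_into UNIV \<tau> = \<sigma>"
      by (simp add: fun_eq_iff cancel(2)[OF tK(1)] cancel(2)[OF tK(2)])
    finally show False using \<sigma>(2) by simp
  qed
  have sums: "(\<Sum>f\<in>R'. f u) = (\<Sum>f\<in>R. f u)" if u: "u \<in> E" for u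
  proof -
    have "v (\<Sum>f\<in>R. f u) = (\<Sum>f\<in>R. f u)" if v: "v \<in> V" for v
    proof -
      have vK: "v \<in> K" using v V(2) by auto
      have "v (\<Sum>f\<in>R. f u) = (\<Sum>f\<in>R. restrict (v \<circ> f) E u)"
        using u by (simp add: galois_automorphism.sum[OF aut[OF vK]])
      also have "\<dots> = (\<Sum>f\<in>(\<lambda>f. restrict (v \<circ> f) E) ` R. f u)"
        by (simp add: sum.reindex[OF injR[OF vK]])
      also have "(\<lambda>f. restrict (v \<circ> f) E) ` R = R"
        using finR in_R[OF v] injR[OF vK] by (intro card_subset_eq) (auto simp: card_image)
      finally show ?thesis .
    qed
    then have "\<sigma> (\<Sum>f\<in>R. f u) = (\<Sum>f\<in>R. f u)" using contra by blast
    then show ?thesis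
      unfolding R'_def using u
      by (simp add: sum.reindex[OF injR[OF \<sigma>(1)]] galois_automorphism.sum[OF aut[OF \<sigma>(1)]])
  qed
  define c :: "('l \<Rightarrow> 'l) \<Rightarrow> 'l" where "c f = (if f \<in> R then 1 else - 1)" for f
  have "\<forall>f\<in>R \<union> R'. c f = 0"
  proof (rule dedekind_independence[where M = E and \<phi> = "\<lambda>f. f"])
    show "finite (R \<union> R')" unfolding R'_def using finR by simp
    fix f assume f: "f \<in> R \<union> R'"
    then obtain \<tau> where t: "\<tau> \<in> K" "f = restrict \<tau> E"
    proof
      assume "f \<in> R" then show ?thesis using that V(2) unfolding R_def by blast
    next
      assume "f \<in> R'"
      then obtain \<tau> where "\<tau> \<in> V" "f = restrict (\<sigma> \<circ> restrict \<tau> E) E" unfolding R_def R'_def by auto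
      then have "f = restrict (\<sigma> \<circ> \<tau>) E" "\<sigma> \<circ> \<tau> \<in> K"
        using Kc(2)[OF \<sigma>(1), of \<tau>] V(2) by (auto simp: fun_eq_iff restrict_def)
      then show ?thesis using that by blast
    qed
    interpret galois_automorphism \<iota> \<tau> by (rule aut[OF t(1)])
    show "f (x * y) = f x * f y" if "x \<in> E" "y \<in> E" for x y
      using that Emult t(2) by simp
    show "\<exists>x\<in>E. f x \<noteq> 0" using E1 t(2) by (intro bexI[of _ 1]) auto
    show "\<exists>x\<in>E. f x \<noteq> h x" if "h \<in> R \<union> R'" "f \<noteq> h" for h
      using extensionalityI[of f E h] ext f that by blast
  next
    fix u assume "u \<in> E"
    have "(\<Sum>f\<in>R \<union> R'. c f * f u) = (\<Sum>f\<in>R. c f * f u) + (\<Sum>f\<in>R'. c f * f u)"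
      using disj finR unfolding R'_def by (intro sum.union_disjoint) auto
    also have "(\<Sum>f\<in>R. c f * f u) = (\<Sum>f\<in>R. f u)" by (simp add: c_def)
    also have "(\<Sum>f\<in>R'. c f * f u) = - (\<Sum>f\<in>R'. f u)"
      using disj by (auto simp: c_def simp flip: sum_negf intro!: sum.cong)
    finally show "(\<Sum>f\<in>R \<union> R'. c f * f u) = 0" using sums[OF \<open>u \<in> E\<close>] by simp
  qed (rule Emult)
  moreover have "restrict id E \<in> R" using Vc(1) unfolding R_def by blast
  ultimately have "c (restrict id E) = 0" "restrict id E \<in> R" by blast+
  then show False by (simp add: c_def)
qed

section \<open>Cyclic extensions of prime power degree\<close>

lemma separable_closure_embedding_zero:
  assumes "separable_closure \<iota>"
  shows "\<iota> 0 = 0"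
proof -
  have "\<iota> (0 + 0) = \<iota> 0 + \<iota> 0"
    using assms unfolding separable_closure_def field_embedding_def by blast
  then show ?thesis by (metis add_0 add_cancel_right_left)
qed

text \<open>The situation produced by the choice of a maximal subgroup avoiding \<open>x\<close>: \<open>V\<close> is a normal subgroup of \<open>K\<close>, the quotient \<open>K / V\<close> is cyclic of order
  \<open>p ^ r\<close> and generated by \<open>g\<close>, and \<open>V\<close> is recovered from its fixed field. So the fixed field of \<open>V\<close> is a
  cyclic extension of degree \<open>p ^ r\<close> of the fixed field of \<open>K\<close>.\<close>

locale cyclic_layer =
  fixes \<iota> :: "'k::field \<Rightarrow> 'l::field" and K V :: "('l \<Rightarrow> 'l) set" and g :: "'l \<Rightarrow> 'l" and p r :: nat
  assumes closure: "separable_closure \<iota>" and roots: "contains_all_roots_of_unity \<iota>"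
    and K: "subgroup K (galois_group \<iota>)" and V_subset: "V \<subseteq> K"
    and V_normal: "\<And>\<sigma> v. \<sigma> \<in> K \<Longrightarrow> v \<in> V \<Longrightarrow> \<exists>v'\<in>V. v \<circ> \<sigma> = \<sigma> \<circ> v'"
    and g: "g \<in> K" and prime_p: "Factorial_Ring.prime p"
    and generates: "\<And>\<sigma>. \<sigma> \<in> K \<Longrightarrow> \<exists>i. \<exists>v\<in>V. \<sigma> = v \<circ> g ^^ i"
    and g_order: "\<And>i. g ^^ i \<in> V \<longleftrightarrow> p ^ r dvd i"
    and separates: "\<And>\<sigma>. \<sigma> \<in> K \<Longrightarrow> \<sigma> \<notin> V \<Longrightarrow> \<exists>y. (\<forall>v\<in>V. v y = y) \<and> \<sigma> y \<noteq> y"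
begin

definition fixed where "fixed = {y. \<forall>v\<in>V. v y = y}"

lemma aut: "\<sigma> \<in> K \<Longrightarrow> galois_automorphism \<iota> \<sigma>"
  using galois_subgroup_closed(5)[OF K] by unfold_locales

lemma g_pow: "g ^^ i \<in> K" using g by (rule galois_subgroup_closed(4)[OF K])

sublocale g: galois_automorphism \<iota> g by (rule aut[OF g])
sublocale gi: galois_automorphism \<iota> "g ^^ i" for i by (rule aut[OF g_pow])

lemma V_aut: "v \<in> V \<Longrightarrow> galois_automorphism \<iota> v"
  using aut V_subset by auto

lemma fixed_fixed: "v \<in> V \<Longrightarrow> y \<in> fixed \<Longrightarrow> v y = y" unfolding fixed_def by auto

lemma fixed_stable: "\<sigma> \<in> K \<Longrightarrow> y \<in> fixed \<Longrightarrow> \<sigma> y \<in> fixed"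
  unfolding fixed_def using V_normal by (fastforce simp: fun_eq_iff)

lemma fixed_pow [intro]: "y \<in> fixed \<Longrightarrow> (g ^^ i) y \<in> fixed" by (rule fixed_stable[OF g_pow])

lemma fixed_ops [intro]:
  "x \<in> fixed \<Longrightarrow> y \<in> fixed \<Longrightarrow> x + y \<in> fixed" "x \<in> fixed \<Longrightarrow> y \<in> fixed \<Longrightarrow> x - y \<in> fixed"
  "x \<in> fixed \<Longrightarrow> y \<in> fixed \<Longrightarrow> x * y \<in> fixed" "x \<in> fixed \<Longrightarrow> y \<in> fixed \<Longrightarrow> x / y \<in> fixed" "x \<in> fixed \<Longrightarrow> x ^ n \<in> fixed"
  "(\<And>i. i \<in> I \<Longrightarrow> f i \<in> fixed) \<Longrightarrow> (\<Sum>i\<in>I. f i) \<in> fixed"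
  unfolding fixed_def
  by (auto simp: galois_automorphism.add[OF V_aut] galois_automorphism.diff[OF V_aut]
      galois_automorphism.mult[OF V_aut] galois_automorphism.divide[OF V_aut]
      galois_automorphism.power[OF V_aut] galois_automorphism.sum[OF V_aut]
      intro!: sum.cong)

lemma fixed_one [intro]: "1 \<in> fixed"
  unfolding fixed_def using galois_automorphism.one[OF V_aut] by auto

lemma fixed_base [intro]: "c \<in> range \<iota> \<Longrightarrow> c \<in> fixed"
  unfolding fixed_def using galois_automorphism.fixes_base[OF V_aut] by auto

lemma g_period: "y \<in> fixed \<Longrightarrow> (g ^^ (p ^ r)) y = y"
  using fixed_fixed[of "g ^^ (p ^ r)"] g_order[of "p ^ r"] by simp

lemma act_on_M: 
  assumes "v \<in> V" "y \<in> fixed"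
  shows "(v \<circ> g ^^ i) y = (g ^^ i) y"
  using fixed_fixed[OF assms(1) fixed_pow[OF assms(2)]] by simp

text \<open>On the fixed field of \<open>V\<close>, the map \<open>\<sigma>\<close> acts as \<open>g ^^ i\<close>, and this action decides membership in
  \<open>V\<close>.\<close>

lemma pow_mem_V_iff:
  assumes "\<sigma> \<in> K" "v \<in> V" "\<sigma> = v \<circ> g ^^ i"
  shows "\<sigma> ^^ m \<in> V \<longleftrightarrow> p ^ r dvd i * m"
proof -
  have act: "(\<sigma> ^^ m) y = (g ^^ (i * m)) y" if "y \<in> fixed" for y
  proof (induction m)
    case (Suc m)
    have "(\<sigma> ^^ Suc m) y = \<sigma> ((g ^^ (i * m)) y)" using Suc by simp
    also have "\<dots> = (g ^^ i) ((g ^^ (i * m)) y)"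
      using act_on_M[OF assms(2) fixed_pow[OF that]] assms(3) by simp
    finally show ?case by (simp add: funpow_add)
  qed simp
  have V_iff: "\<tau> \<in> V \<longleftrightarrow> (\<forall>y\<in>fixed. \<tau> y = y)" if "\<tau> \<in> K" for \<tau>
    using separates[OF that] fixed_fixed unfolding fixed_def by blast
  have "\<sigma> ^^ m \<in> V \<longleftrightarrow> g ^^ (i * m) \<in> V"
    using V_iff[OF g_pow] V_iff[OF galois_subgroup_closed(4)[OF K assms(1)]] act by simp
  then show ?thesis by (simp add: g_order)
qed

text \<open>The powers of \<open>g\<close> below \<open>p ^ r\<close> are distinct characters of the fixed field of \<open>V\<close>, so no nontrivial linear
  combination of them vanishes. The coefficients \<open>1\<close> give an element of nonzero trace, the powers of a
  root of unity give a Lagrange resolvent.\<close>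

lemma exists_resolvent:
  assumes "c 0 \<noteq> 0"
  shows "\<exists>y\<in>fixed. (\<Sum>i<p ^ r. c i * (g ^^ i) y) \<noteq> 0"
proof (rule ccontr)
  assume contra: "\<not> ?thesis"
  have "\<forall>i\<in>{..<p ^ r}. c i = 0"
  proof (rule dedekind_independence[where M = fixed and \<phi> = "\<lambda>i. g ^^ i"])
    show "\<exists>x\<in>fixed. (g ^^ i) x \<noteq> 0" for i
by (rule bexI[OF _ fixed_one]) simp
    have distinct: "\<exists>x\<in>fixed. (g ^^ i) x \<noteq> (g ^^ j) x" if "i < j" "j < p ^ r" for i j
    proof -
      have "\<not> p ^ r dvd j - i" using that by (auto dest: dvd_imp_le)
      then obtain y where y: "y \<in> fixed" "(g ^^ (j - i)) y \<noteq> y"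
        using separates[OF g_pow] g_order unfolding fixed_def by blast
      have "(g ^^ j) y = (g ^^ i) ((g ^^ (j - i)) y)"
        using that by (simp flip: funpow_add comp_apply[of "g ^^ i"])
      then have "(g ^^ j) y \<noteq> (g ^^ i) y" using y(2) gi.inj by (metis injD)
      then show ?thesis using y(1) by metis
    qed
    then show "\<exists>x\<in>fixed. (g ^^ i) x \<noteq> (g ^^ j) x" if "i \<in> {..<p ^ r}" "j \<in> {..<p ^ r}" "i \<noteq> j" for i j
      using that by (metis lessThan_iff linorder_neqE_nat)
  qed (use contra in auto)
  moreover have "p ^ r > 0" using prime_p by (simp add: prime_gt_0_nat)
  ultimately show False using assms by auto
qed

lemma sum_cyclic_shift:
  fixes f :: "nat \<Rightarrow> 'b::ab_group_add"
  assumes "f n = f 0"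
  shows "(\<Sum>i<n. f (Suc i)) = (\<Sum>i<n. f i)"
  using sum.lessThan_Suc_shift[of f n] assms by (simp add: add.commute)

text \<open>Away from the characteristic, a nonzero Lagrange resolvent \<open>a\<close> satisfies \<open>g a = \<omega> * a\<close> with \<open>\<omega>\<close> of order
  \<open>p ^ r\<close>, so \<open>K\<close> multiplies \<open>a\<close>, and hence also \<open>b\<close> with \<open>b ^ p = a\<close>, by roots of unity. As these lie in
  the base field, \<open>K\<close> acts commutatively on \<open>b\<close>. If \<open>x b = \<zeta> * b\<close>, then \<open>(x ^^ p) b = \<zeta> ^ p * b\<close>, and
  \<open>\<zeta> ^ p = x a / a\<close> is not \<open>1\<close> because \<open>x\<close> is not in \<open>V\<close>.\<close>

theorem kummer_witness:
  assumes p: "of_nat p \<noteq> (0::'l)" and x: "x \<in> K" "x \<notin> V" "x ^^ p \<in> V"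
  shows "\<exists>w. (\<forall>\<sigma>\<in>K. \<forall>\<tau>\<in>K. \<sigma> (\<tau> w) = \<tau> (\<sigma> w)) \<and> (x ^^ p) w \<noteq> w"
proof -
  let ?n = "p ^ r"
  have p0: "p > 0" using prime_p by (rule prime_gt_0_nat)
  obtain \<omega> :: 'l where \<omega>: "\<omega> \<noteq> 0" "\<And>i. \<omega> ^ i = 1 \<longleftrightarrow> ?n dvd i"
    using separable_closure_exists_primitive_root_of_unity[OF closure prime_p p] by blast
  have root: "\<zeta> \<in> range \<iota>" if "\<zeta> ^ m = 1" "m > 0" for \<zeta> m
    using roots that unfolding contains_all_roots_of_unity_def by blast
  have \<omega>n: "\<omega> ^ ?n = 1" using \<omega>(2) by simp
  have \<omega>k: "\<omega> ^ i \<in> range \<iota>" for i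
  proof (rule root)
    have "(\<omega> ^ i) ^ ?n = (\<omega> ^ ?n) ^ i" by (simp only: power_mult[symmetric] mult.commute)
    then show "(\<omega> ^ i) ^ ?n = 1" using \<omega>n by simp
  qed (use p0 in simp)
  obtain y where y: "y \<in> fixed" "(\<Sum>i<?n. (1 / \<omega> ^ i) * (g ^^ i) y) \<noteq> 0"
    using exists_resolvent[of "\<lambda>i. 1 / \<omega> ^ i"] by auto
  define a where "a = (\<Sum>i<?n. (1 / \<omega> ^ i) * (g ^^ i) y)"
  have a0: "a \<noteq> 0" using y(2) a_def by simp
  have aM: "a \<in> fixed" unfolding a_def
    using \<omega>k y(1) by (intro fixed_ops(6) fixed_ops(3)[OF fixed_ops(4)[OF fixed_one fixed_base]] fixed_pow)
  have "g a = (\<Sum>i<?n. (1 / \<omega> ^ i) * (g ^^ Suc i) y)"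
    unfolding a_def using g.fixes_base[OF \<omega>k] by simp
  also have "\<dots> = \<omega> * (\<Sum>i<?n. (1 / \<omega> ^ Suc i) * (g ^^ Suc i) y)"
    using \<omega>(1) by (simp add: sum_distrib_left mult.assoc[symmetric])
  also have "(\<Sum>i<?n. (1 / \<omega> ^ Suc i) * (g ^^ Suc i) y) = a"
    unfolding a_def using g_period[OF y(1)] \<omega>n
    by (intro sum_cyclic_shift[where f = "\<lambda>i. (1 / \<omega> ^ i) * (g ^^ i) y"]) simp
  finally have ga: "g a = \<omega> * a" .
  have gia: "(g ^^ i) a = \<omega> ^ i * a" for i
    using g.fixes_base[OF \<omega>k] by (induction i) (simp_all add: ga g.fixes_base[OF \<omega>k[of 1], simplified])
  obtain b where b: "b ^ p = a"
    using separable_closure_exists_root_of_power[OF closure p0 p] by blast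
  have b0: "b \<noteq> 0" using a0 b p0 by auto
  have eig: "\<exists>\<zeta>\<in>range \<iota>. \<sigma> b = \<zeta> * b \<and> \<zeta> ^ p = \<sigma> a / a" if \<sigma>: "\<sigma> \<in> K" for \<sigma>
  proof
    interpret galois_automorphism \<iota> \<sigma> by (rule aut[OF \<sigma>])
    let ?\<zeta> = "\<sigma> b / b"
    have z: "?\<zeta> ^ p = \<sigma> a / a" by (simp add: power_divide b flip: power)
    obtain i v where iv: "v \<in> V" "\<sigma> = v \<circ> g ^^ i" using generates[OF \<sigma>] by blast
    have "\<sigma> a / a = \<omega> ^ i" using act_on_M[OF iv(1) aM] iv(2) gia a0 by simp
    then have "?\<zeta> ^ (p * ?n) = (\<omega> ^ i) ^ ?n" using z by (simp only: power_mult)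
    also have "\<dots> = (\<omega> ^ ?n) ^ i" by (simp only: power_mult[symmetric] mult.commute)
    finally have "?\<zeta> ^ (p * ?n) = (\<omega> ^ ?n) ^ i" .
    then show "?\<zeta> \<in> range \<iota>" using root[of ?\<zeta> "p * ?n"] \<omega>n p0 by simp
    show "\<sigma> b = ?\<zeta> * b \<and> ?\<zeta> ^ p = \<sigma> a / a" using z b0 by simp
  qed
  have comm: "\<sigma> (\<tau> b) = \<tau> (\<sigma> b)" if \<sigma>: "\<sigma> \<in> K" and \<tau>: "\<tau> \<in> K" for \<sigma> \<tau>
  proof -
    obtain \<zeta> \<zeta>' where z: "\<zeta> \<in> range \<iota>" "\<sigma> b = \<zeta> * b" "\<zeta>' \<in> range \<iota>" "\<tau> b = \<zeta>' * b"
      using eig[OF \<sigma>] eig[OF \<tau>] by blast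
    then show ?thesis
      using galois_automorphism.fixes_base[OF aut[OF \<sigma>] z(3)] galois_automorphism.fixes_base[OF aut[OF \<tau>] z(1)]
        galois_automorphism.mult[OF aut[OF \<sigma>]] galois_automorphism.mult[OF aut[OF \<tau>]] by simp
  qed
  interpret x: galois_automorphism \<iota> x by (rule aut[OF x(1)])
  obtain \<zeta> where \<zeta>: "\<zeta> \<in> range \<iota>" "x b = \<zeta> * b" "\<zeta> ^ p = x a / a" using eig[OF x(1)] by blast
  obtain j v where j: "v \<in> V" "x = v \<circ> g ^^ j" using generates[OF x(1)] by blast
  have "\<not> ?n dvd j" using pow_mem_V_iff[OF x(1) j, of 1] x(2) by simp
  moreover have "x a / a = \<omega> ^ j" using act_on_M[OF j(1) aM] j(2) gia a0 by simp
  ultimately have "\<zeta> ^ p \<noteq> 1" using \<omega>(2) \<zeta>(3) by simp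
  moreover have "(x ^^ i) b = \<zeta> ^ i * b" for i
    using x.fixes_base[OF \<zeta>(1)] by (induction i) (simp_all add: \<zeta>(2))
  ultimately have "(x ^^ p) b \<noteq> b" using b0 by simp
  then show ?thesis using comm by blast
qed

text \<open>In characteristic \<open>p\<close>, the cyclic extension of degree \<open>p ^ r\<close> is embedded into one of degree
  \<open>p ^ (r + 1)\<close> by a construction of Albert. Take \<open>\<beta>\<close> of trace \<open>1\<close>; then \<open>\<beta> ^ p - \<beta>\<close> has trace \<open>0\<close>, so it
  equals \<open>g y - y\<close> for some \<open>y\<close> by the additive form of Hilbert's Theorem 90. Let \<open>z ^ p - z = y\<close>. Then
  \<open>g z - z - \<beta>\<close> is an element \<open>c\<close> of the prime field, and \<open>V\<close> moves \<open>z\<close> by elements of the prime field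
  only. So \<open>K\<close> acts commutatively on \<open>z\<close>, while \<open>g ^^ (p ^ r)\<close> moves \<open>z\<close> by the trace of \<open>\<beta> + c\<close>, which
  is \<open>1\<close>. Since \<open>x\<close> is congruent modulo \<open>V\<close> to a power \<open>g ^^ j\<close> with \<open>p ^ r\<close> dividing \<open>j * p\<close> but not \<open>j\<close>,
  its \<open>p\<close>-th power moves \<open>z\<close> too.\<close>

theorem artin_schreier_witness:
  assumes char: "of_nat p = (0::'l)" and x: "x \<in> K" "x \<notin> V" "x ^^ p \<in> V"
  shows "\<exists>w. (\<forall>\<sigma>\<in>K. \<forall>\<tau>\<in>K. \<sigma> (\<tau> w) = \<tau> (\<sigma> w)) \<and> (x ^^ p) w \<noteq> w"
proof -
  let ?n = "p ^ r"
  have p1: "p > 1" using prime_p by (rule prime_gt_1_nat)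
  have CHAR: "CHAR('l) = p"
  proof -
    have "CHAR('l) dvd p" using char by (simp add: of_nat_eq_0_iff_char_dvd)
    moreover have "CHAR('l) \<noteq> 1" using of_nat_eq_0_iff_char_dvd[of 1, where 'a = 'l] by auto
    ultimately show ?thesis using prime_p unfolding prime_nat_iff by blast
  qed
  have frob_add: "(a + b) ^ p = a ^ p + b ^ p" for a b :: 'l
    using prime_p CHAR by (intro freshmans_dream) auto
  have frob_sum: "(\<Sum>i\<in>I. f i) ^ p = (\<Sum>i\<in>I. f i ^ p)" for I and f :: "nat \<Rightarrow> 'l"
    using prime_p CHAR by (intro freshmans_dream_sum) auto
  have frob_diff: "(a - b) ^ p = a ^ p - b ^ p" for a b :: 'l
    using frob_add[of "a - b" b] by simp
  \<comment> \<open>The nonzero elements of the prime field are roots of unity of order dividing \<open>p - 1\<close>.\<close>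
  have prime_field: "c \<in> range \<iota>" if "c ^ p = c" for c :: 'l
  proof (cases "c = 0")
    case True
    then show ?thesis using separable_closure_embedding_zero[OF closure] by (metis rangeI)
  next
    case False
    have "c ^ (p - 1) * c = c ^ p" using p1 by (intro power_minus_mult) simp
    then have "c ^ (p - 1) = 1" using False that by simp
    moreover have "p - 1 > 0" using p1 by simp
    ultimately show ?thesis using roots unfolding contains_all_roots_of_unity_def by blast
  qed
  have range_add: "a + b \<in> range \<iota>" if ab: "a \<in> range \<iota>" "b \<in> range \<iota>" for a b
  proof -
    obtain a' b' where "a = \<iota> a'" "b = \<iota> b'" using ab by blast
    then have "a + b = \<iota> (a' + b')"
      using closure unfolding separable_closure_def field_embedding_def by simp
    then show ?thesis by blast
  qed
  obtain j v\<^sub>0 where j: "v\<^sub>0 \<in> V" "x = v\<^sub>0 \<circ> g ^^ j" using generates[OF x(1)] by blast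
  have ndvd: "\<not> ?n dvd j" and dvd: "?n dvd j * p"
    using pow_mem_V_iff[OF x(1) j, of 1] pow_mem_V_iff[OF x(1) j, of p] x by auto
  have "r \<noteq> 0" using ndvd by (intro notI) simp
  then have n_char: "of_nat ?n = (0::'l)" using char by simp
  obtain u where u: "u \<in> fixed" "(\<Sum>i<?n. 1 * (g ^^ i) u) \<noteq> 0"
    using exists_resolvent[of "\<lambda>i. 1"] by auto
  define T where "T = (\<Sum>i<?n. (g ^^ i) u)"
  have T0: "T \<noteq> 0" using u(2) T_def by simp
  have "g T = (\<Sum>i<?n. (g ^^ Suc i) u)" unfolding T_def by simp
  also have "\<dots> = T" unfolding T_def
    using g_period[OF u(1)] by (intro sum_cyclic_shift[where f = "\<lambda>i. (g ^^ i) u"]) simp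
  finally have gT: "(g ^^ i) T = T" for i by (induction i) auto
  define \<beta> where "\<beta> = u / T"
  have \<beta>fixed: "\<beta> \<in> fixed" unfolding \<beta>_def T_def using u(1) by (intro fixed_ops(4) fixed_ops(6) fixed_pow)
  have tr\<beta>: "(\<Sum>i<?n. (g ^^ i) \<beta>) = 1"
    unfolding \<beta>_def using T0 by (simp add: gT flip: sum_divide_distrib) (simp add: T_def)
  have tr\<beta>_Suc: "(\<Sum>i<?n. (g ^^ Suc i) \<beta>) = 1"
    using sum_cyclic_shift[where f = "\<lambda>i. (g ^^ i) \<beta>" and n = ?n] g_period[OF \<beta>fixed] tr\<beta> by simp
  define w where "w = \<beta> ^ p - \<beta>"
  have wM: "w \<in> fixed" unfolding w_def using \<beta>fixed by (intro fixed_ops(2) fixed_ops(5))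
  \<comment> \<open>The explicit primitive in the additive Theorem 90: the partial sums of the trace of \<open>w\<close>, weighted by
    the conjugates of \<open>\<beta>\<close>.\<close>
  define S where "S i = (\<Sum>t<i. (g ^^ t) w)" for i
  have "S ?n = (\<Sum>i<?n. (g ^^ i) \<beta>) ^ p - (\<Sum>i<?n. (g ^^ i) \<beta>)"
    unfolding S_def w_def frob_sum by (simp add: sum_subtractf)
  then have Sn: "S ?n = 0" using tr\<beta> by simp
  have gS: "g (S i) = S (Suc i) - w" for i
    unfolding S_def sum.lessThan_Suc_shift by simp
  define y where "y = - (\<Sum>i<?n. S i * (g ^^ i) \<beta>)"
  have SM: "S i \<in> fixed" for i unfolding S_def using wM by (intro fixed_ops(6) fixed_pow)
  have "(\<Sum>i<?n. S i * (g ^^ i) \<beta>) \<in> fixed" using \<beta>fixed SM by (intro fixed_ops(6) fixed_ops(3) fixed_pow)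
  then have yM: "y \<in> fixed" unfolding y_def using fixed_ops(2)[OF fixed_ops(2)[OF fixed_one fixed_one]] by force
  have "g (- y) = (\<Sum>i<?n. (S (Suc i) - w) * (g ^^ Suc i) \<beta>)" unfolding y_def by (simp add: gS)
  also have "\<dots> = (\<Sum>i<?n. S (Suc i) * (g ^^ Suc i) \<beta>) - w * (\<Sum>i<?n. (g ^^ Suc i) \<beta>)"
    by (simp only: left_diff_distrib sum_subtractf sum_distrib_left)
  also have "(\<Sum>i<?n. S (Suc i) * (g ^^ Suc i) \<beta>) = - y"
    unfolding y_def minus_minus
    by (rule sum_cyclic_shift[where f = "\<lambda>i. S i * (g ^^ i) \<beta>"]) (simp add: Sn, simp add: S_def)
  finally have gy: "g y = y + w" using tr\<beta>_Suc by (simp add: algebra_simps)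
  obtain z where z: "z ^ p - z = y"
    using separable_closure_exists_artin_schreier_root[OF closure p1 char] by blast
  define c where "c = g z - z - \<beta>"
  have "c ^ p - c = g (z ^ p - z) - (z ^ p - z) - (\<beta> ^ p - \<beta>)"
    unfolding c_def frob_diff by (simp add: algebra_simps)
  then have "c ^ p = c" using z gy w_def by simp
  then have ck: "c \<in> range \<iota>" by (rule prime_field)
  \<comment> \<open>\<open>m\<close> is the cocycle of \<open>z\<close> along the powers of \<open>g\<close>, and \<open>d\<close> below its analogue on \<open>V\<close>.\<close>
  define m where "m i = (g ^^ i) z - z" for i
  have m_add: "m (i + j) = m i + (g ^^ i) (m j)" for i j
    unfolding m_def by (simp add: funpow_add)
  have m_eq: "m i = (\<Sum>t<i. (g ^^ t) \<beta>) + of_nat i * c" for i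
  proof (induction i)
    case 0
    then show ?case by (simp add: m_def)
  next
    case (Suc i)
    have "m (Suc i) = (\<beta> + c) + g (m i)" unfolding m_def c_def by simp
    also have "g (m i) = (\<Sum>t<i. (g ^^ Suc t) \<beta>) + of_nat i * c"
      unfolding Suc using g.fixes_base[OF ck] by (simp add: g.of_nat)
    finally show ?case unfolding sum.lessThan_Suc_shift by (simp add: algebra_simps)
  qed
  have mM: "m i \<in> fixed" for i
  proof (induction i)
    case 0
    then show ?case using fixed_ops(2)[OF fixed_one fixed_one] by (simp add: m_def)
  next
    case (Suc i)
    have "m (Suc i) = (\<beta> + c) + (g ^^ 1) (m i)" unfolding m_def c_def by simp
    then show ?case using Suc \<beta>fixed ck by (metis fixed_ops(1) fixed_base fixed_pow)
  qed
  have mn: "m (?n * t) = of_nat t" for t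
  proof (induction t)
    case 0
    then show ?case by (simp add: m_def)
  next
    case (Suc t)
    have "m (?n * Suc t) = m ?n + (g ^^ ?n) (m (?n * t))" using m_add[of ?n "?n * t"] by simp
    also have "\<dots> = 1 + of_nat t" using g_period[OF mM] Suc m_eq[of ?n] tr\<beta> n_char by simp
    finally show ?case by simp
  qed
  define d where "d v = v z - z" for v :: "'l \<Rightarrow> 'l"
  have dk: "d v \<in> range \<iota>" if v: "v \<in> V" for v
  proof (rule prime_field)
    interpret galois_automorphism \<iota> v by (rule V_aut[OF v])
    have "d v ^ p - d v = v (z ^ p - z) - (z ^ p - z)"
      unfolding d_def frob_diff by (simp add: algebra_simps)
    then show "d v ^ p = d v" using fixed_fixed[OF v yM] z by simp
  qed
  have act_z: "(v \<circ> g ^^ i) z = z + d v + m i" if v: "v \<in> V" for v i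
  proof -
    interpret galois_automorphism \<iota> v by (rule V_aut[OF v])
    have "(v \<circ> g ^^ i) z = v (z + m i)" by (simp add: m_def)
    then show ?thesis using fixed_fixed[OF v mM] by (simp add: d_def)
  qed
  have act_add: "(v \<circ> g ^^ i) (z + b + m l) = z + d v + b + m (i + l)"
    if v: "v \<in> V" and b: "b \<in> range \<iota>" for v i b l
  proof -
    interpret v: galois_automorphism \<iota> v by (rule V_aut[OF v])
    have "(v \<circ> g ^^ i) (z + b + m l) = (v \<circ> g ^^ i) z + b + (v \<circ> g ^^ i) (m l)"
      using v.fixes_base[OF b] gi.fixes_base[OF b] by simp
    then show ?thesis
      unfolding act_z[OF v] act_on_M[OF v mM] m_add by simp
  qed
  have comm: "\<sigma> (\<tau> z) = \<tau> (\<sigma> z)" if \<sigma>: "\<sigma> \<in> K" and \<tau>: "\<tau> \<in> K" for \<sigma> \<tau>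
  proof -
    obtain i v i' v' where iv: "v \<in> V" "\<sigma> = v \<circ> g ^^ i" "v' \<in> V" "\<tau> = v' \<circ> g ^^ i'"
      using generates[OF \<sigma>] generates[OF \<tau>] by blast
    show ?thesis
      unfolding iv(2,4) act_z[OF iv(1)] act_z[OF iv(3)]
        act_add[OF iv(1) dk[OF iv(3)]] act_add[OF iv(3) dk[OF iv(1)]]
      by (simp add: add.commute add.left_commute)
  qed
  have dk_mult: "of_nat i * d v\<^sub>0 \<in> range \<iota>" for i
  proof (induction i)
    case 0
    then show ?case using prime_field[of 0] p1 by simp
  next
    case (Suc i)
    then show ?case using range_add[OF Suc dk[OF j(1)]] by (simp add: algebra_simps)
  qed
  have x_pow: "(x ^^ i) z = z + of_nat i * d v\<^sub>0 + m (j * i)" for i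
  proof (induction i)
    case 0
    then show ?case by (simp add: m_def)
  next
    case (Suc i)
    have "(x ^^ Suc i) z = x (z + of_nat i * d v\<^sub>0 + m (j * i))"
      using Suc by simp
    also have "\<dots> = (v\<^sub>0 \<circ> g ^^ j) (z + of_nat i * d v\<^sub>0 + m (j * i))"
      by (simp only: j(2))
    also have "\<dots> = z + d v\<^sub>0 + of_nat i * d v\<^sub>0 + m (j + j * i)"
      by (rule act_add[OF j(1) dk_mult])
    finally show ?case by (simp add: algebra_simps)
  qed
  obtain t where t: "j * p = ?n * t" using dvd by (elim dvdE)
  have "\<not> p dvd t"
  proof
    assume "p dvd t"
    then obtain t' where "t = t' * p" by (metis dvdE mult.commute)
    then have "j = ?n * t'" using t p1 by simp
    then show False using ndvd by simp
  qed
  then have "of_nat t \<noteq> (0::'l)" by (simp add: of_nat_eq_0_iff_char_dvd CHAR)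
  then have "(x ^^ p) z \<noteq> z" using x_pow[of p] t mn char by simp
  then show ?thesis using comm by blast
qed

end

section \<open>The Krull topology\<close>

lemma separable_closure_algebraic:
  fixes \<iota> :: "'k::field \<Rightarrow> 'l::field"
  assumes "separable_closure \<iota>"
  shows "\<exists>q. map_poly \<iota> q \<noteq> 0 \<and> poly (map_poly \<iota> q) x = 0"
proof -
  obtain q where q: "Factorial_Ring.irreducible q" "poly (map_poly \<iota> q) x = 0"
    using assms unfolding separable_closure_def separable_element_def by blast
  have inj: "a = 0" if "\<iota> a = 0" for a
  proof (rule ccontr)
    assume "a \<noteq> 0"
    have "\<iota> (a * inverse a) = \<iota> a * \<iota> (inverse a)" "\<iota> 1 = 1"
      using assms unfolding separable_closure_def field_embedding_def by blast+
    then show False using that \<open>a \<noteq> 0\<close> by simp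
  qed
  have "q \<noteq> 0" using q(1) by auto
  then have "\<iota> (Polynomial.lead_coeff q) \<noteq> 0" using inj leading_coeff_0_iff by blast
  then have "Polynomial.coeff (map_poly \<iota> q) (Polynomial.degree q) \<noteq> 0"
    by (simp add: coeff_map_poly separable_closure_embedding_zero[OF assms])
  then have "map_poly \<iota> q \<noteq> 0" by auto
  then show ?thesis using q(2) by blast
qed

text \<open>Automorphisms permute the roots in \<open>'l\<close> of a polynomial over \<open>'k\<close>.\<close>

lemma exists_finite_stable_superset:
  fixes \<iota> :: "'k::field \<Rightarrow> 'l::field"
  assumes "separable_closure \<iota>" "finite A"
  shows "\<exists>S. finite S \<and> A \<subseteq> S \<and> (\<forall>\<sigma>\<in>carrier (galois_group \<iota>). \<forall>s\<in>S. \<sigma> s \<in> S)"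
proof -
  obtain q where q: "\<And>x. map_poly \<iota> (q x) \<noteq> 0" "\<And>x. poly (map_poly \<iota> (q x)) x = 0"
    using separable_closure_algebraic[OF assms(1)] by metis
  let ?S = "\<Union>a\<in>A. {x. poly (map_poly \<iota> (q a)) x = 0}"
  have "finite ?S" using assms(2) q(1) by (auto intro: poly_roots_finite)
  moreover have "A \<subseteq> ?S" using q(2) by auto
  moreover have "\<sigma> s \<in> ?S" if "\<sigma> \<in> carrier (galois_group \<iota>)" "s \<in> ?S" for \<sigma> s
  proof -
    interpret galois_automorphism \<iota> \<sigma> using that(1) by unfold_locales
    show ?thesis
      using that(2) by (auto simp flip: poly_map_poly[OF separable_closure_embedding_zero[OF assms(1)]])
  qed
  ultimately show ?thesis by (intro exI[of _ ?S] conjI ballI)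
qed

lemma subfield_range_embedding:
  fixes \<iota> :: "'k::field \<Rightarrow> 'l::field"
  assumes "field_embedding \<iota>"
  shows "subfield (range \<iota>) ring_of_type_algebra"
proof -
  let ?R = "ring_of_type_algebra :: 'l ring"
  interpret R: field ?R by (rule field_from_type_algebra)
  have emb: "\<iota> (a + b) = \<iota> a + \<iota> b" "\<iota> (a * b) = \<iota> a * \<iota> b" "\<iota> 1 = 1" for a b
    using assms unfolding field_embedding_def by auto
  have "\<iota> (0 + 0) = \<iota> 0 + \<iota> 0" by (rule emb)
  then have "\<iota> 0 = 0" by (metis add_0 add_cancel_right_left)
  have carr: "x \<in> carrier ?R" for x by (simp add: ring_of_type_algebra_def)
  have ops: "x \<otimes>\<^bsub>?R\<^esub> y = x * y" "x \<oplus>\<^bsub>?R\<^esub> y = x + y" "\<one>\<^bsub>?R\<^esub> = 1" "\<zero>\<^bsub>?R\<^esub> = 0" for x y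
    by (simp_all add: ring_of_type_algebra_def)
  have neg: "\<ominus>\<^bsub>?R\<^esub> \<iota> a = \<iota> (- a)" for a
  proof (rule R.minus_equality)
    show "\<iota> (- a) \<oplus>\<^bsub>?R\<^esub> \<iota> a = \<zero>\<^bsub>?R\<^esub>" using emb(1)[of "- a" a] \<open>\<iota> 0 = 0\<close> by (simp add: ops)
  qed (simp_all add: carr)
  have "subring (range \<iota>) ?R"
    by (rule R.subringI) (auto simp: carr ops neg simp flip: emb)
  then show ?thesis
  proof (rule R.subfieldI')
    fix x assume "x \<in> range \<iota> - {\<zero>\<^bsub>?R\<^esub>}"
    then obtain a where a: "x = \<iota> a" "a \<noteq> 0" using \<open>\<iota> 0 = 0\<close> by (auto simp: ops)
    have "inv\<^bsub>?R\<^esub> x = \<iota> (inverse a)"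
      using a emb(2)[of a "inverse a"] emb(2)[of "inverse a" a] emb(3)
      by (intro R.comm_inv_char) (auto simp: carr ops)
    then show "inv\<^bsub>?R\<^esub> x \<in> range \<iota>" by simp
  qed
qed

lemma eval_ring_of_type_algebra:
  "ring.eval (ring_of_type_algebra :: 'l::field ring) cs x = poly (Poly (rev cs)) x"
proof -
  let ?R = "ring_of_type_algebra :: 'l ring"
  interpret R: field ?R by (rule field_from_type_algebra)
  have ops: "a \<otimes>\<^bsub>?R\<^esub> b = a * b" "a \<oplus>\<^bsub>?R\<^esub> b = a + b" "\<zero>\<^bsub>?R\<^esub> = 0" for a b
    by (simp_all add: ring_of_type_algebra_def)
  have pow: "x [^]\<^bsub>?R\<^esub> n = x ^ n" for n :: nat
    by (induction n) (simp_all add: ring_of_type_algebra_def nat_pow_def mult.commute)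
  show ?thesis
    by (induction cs) (simp_all add: ops pow Poly_append poly_monom)
qed

lemma exists_finite_intermediate_field:
  fixes \<iota> :: "'k::field \<Rightarrow> 'l::field"
  assumes "separable_closure \<iota>"
  shows "\<exists>F. finite_intermediate_field \<iota> F \<and> x \<in> F"
proof -
  let ?R = "ring_of_type_algebra :: 'l ring"
  interpret R: field ?R by (rule field_from_type_algebra)
  have sub: "subfield (range \<iota>) ?R"
    using assms unfolding separable_closure_def by (intro subfield_range_embedding) simp
  have x: "x \<in> carrier ?R" and zero: "\<zero>\<^bsub>?R\<^esub> = 0" by (simp_all add: ring_of_type_algebra_def)
  obtain q where q: "map_poly \<iota> q \<noteq> 0" "poly (map_poly \<iota> q) x = 0"
    using separable_closure_algebraic[OF assms] by blast
  let ?cs = "rev (coeffs (map_poly \<iota> q))"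
  have "?cs \<noteq> []" using q(1) by simp
  moreover have "set ?cs \<subseteq> range \<iota>"
    using separable_closure_embedding_zero[OF assms] 
    by (auto simp: coeffs_def coeff_map_poly)
  moreover have "hd ?cs \<noteq> 0" using q(1) by (simp add: hd_rev last_coeffs_eq_coeff_degree)
  ultimately have "?cs \<in> carrier (univ_poly ?R (range \<iota>))"
    by (simp add: univ_poly_def polynomial_def zero)
  moreover have "R.eval ?cs x = \<zero>\<^bsub>?R\<^esub>"
    using q(2) by (simp add: eval_ring_of_type_algebra zero)
  ultimately have alg: "(R.algebraic over (range \<iota>)) x"
    using \<open>?cs \<noteq> []\<close> by (intro R.algebraicI)
  let ?F = "R.simple_extension (range \<iota>) x"
  have "finite_intermediate_field \<iota> ?F"
    unfolding finite_intermediate_field_def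
    using R.simple_extension_is_subfield[OF sub x] R.finite_dimension_simple_extension[OF sub x] alg
      R.simple_extension_incl[OF subfieldE(3)[OF sub] x] by simp
  moreover have "x \<in> ?F" by (rule R.simple_extension_mem[OF subfieldE(1)[OF sub] x])
  ultimately show ?thesis by blast
qed

text \<open>A basis of \<open>F\<close> over the base field serves as \<open>S\<close>.\<close>

lemma finite_intermediate_field_determined:
  fixes \<iota> :: "'k::field \<Rightarrow> 'l::field"
  assumes "field_embedding \<iota>" "finite_intermediate_field \<iota> F"
  shows "\<exists>S. finite S \<and> S \<subseteq> F \<and> (\<forall>\<sigma>\<in>carrier (galois_group \<iota>). \<forall>\<tau>\<in>carrier (galois_group \<iota>).
    (\<forall>s\<in>S. \<sigma> s = \<tau> s) \<longrightarrow> (\<forall>y\<in>F. \<sigma> y = \<tau> y))"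
proof -
  let ?R = "ring_of_type_algebra :: 'l ring"
  interpret R: field ?R by (rule field_from_type_algebra)
  have sub: "subfield (range \<iota>) ?R" by (rule subfield_range_embedding[OF assms(1)])
  obtain n where "R.dimension n (range \<iota>) F"
    using assms(2) unfolding finite_intermediate_field_def R.finite_dimension_def by blast
  then obtain Vs where Vs: "set Vs \<subseteq> carrier ?R" "R.Span (range \<iota>) Vs = F"
    using R.exists_base[OF sub] by blast
  have "\<sigma> y = \<tau> y" if "\<sigma> \<in> carrier (galois_group \<iota>)" "\<tau> \<in> carrier (galois_group \<iota>)"
    "\<forall>s\<in>set us. \<sigma> s = \<tau> s" "y \<in> R.Span (range \<iota>) us" for \<sigma> \<tau> us y
    using that(3,4)
  proof (induction us arbitrary: y)
    case Nil
    interpret s: galois_automorphism \<iota> \<sigma> using that(1) by unfold_locales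
    interpret t: galois_automorphism \<iota> \<tau> using that(2) by unfold_locales
    have "\<zero>\<^bsub>?R\<^esub> = 0" by (simp add: ring_of_type_algebra_def)
    then show ?case using Nil by simp
  next
    case (Cons u us)
    interpret s: galois_automorphism \<iota> \<sigma> using that(1) by unfold_locales
    interpret t: galois_automorphism \<iota> \<tau> using that(2) by unfold_locales
    obtain k v where "k \<in> range \<iota>" "v \<in> R.Span (range \<iota>) us" "y = k * u + v"
      using Cons.prems(2) by (auto simp: R.line_extension_mem_iff) (auto simp: ring_of_type_algebra_def)
    then show ?case
      using Cons s.fixes_base t.fixes_base by simp
  qed
  moreover have "set Vs \<subseteq> F"
    using R.Span_base_incl[OF sub Vs(1)] Vs(2) by simp
  ultimately show ?thesis using Vs(2) by (intro exI[of _ "set Vs"]) blast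
qed

lemma coset_fixing_subgroup:
  assumes "\<sigma> \<in> carrier (galois_group \<iota>)"
  shows "\<sigma> <#\<^bsub>galois_group \<iota>\<^esub> fixing_subgroup \<iota> F = {\<tau> \<in> carrier (galois_group \<iota>). \<forall>y\<in>F. \<tau> y = \<sigma> y}"
proof -
  interpret group "galois_group \<iota>" by (rule group_galois_group)
  have "\<sigma> \<circ> \<rho> \<in> carrier (galois_group \<iota>)" if "\<rho> \<in> carrier (galois_group \<iota>)" for \<rho>
    using m_closed[OF assms that] by simp
  moreover have "\<exists>\<rho>\<in>fixing_subgroup \<iota> F. \<tau> = \<sigma> \<circ> \<rho>"
    if t: "\<tau> \<in> carrier (galois_group \<iota>)" "\<forall>y\<in>F. \<tau> y = \<sigma> y" for \<tau>
  proof
    have bij: "bij \<sigma>" using assms by (simp add: galois_group_mem)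
    have "inv_into UNIV \<sigma> \<circ> \<tau> \<in> carrier (galois_group \<iota>)"
      using m_closed[OF inv_closed[OF assms] t(1)] galois_group_inv[OF assms] by simp
    then show "inv_into UNIV \<sigma> \<circ> \<tau> \<in> fixing_subgroup \<iota> F"
      using t(2) bij by (simp add: fixing_subgroup_def bij_is_inj)
    show "\<tau> = \<sigma> \<circ> (inv_into UNIV \<sigma> \<circ> \<tau>)"
      using bij by (simp add: fun_eq_iff bij_is_surj surj_f_inv_f)
  qed
  ultimately show ?thesis
    unfolding l_coset_def by (auto simp: fixing_subgroup_def)
qed

definition agreeing :: "('k::field \<Rightarrow> 'l::field) \<Rightarrow> ('l \<Rightarrow> 'l) \<Rightarrow> 'l set \<Rightarrow> ('l \<Rightarrow> 'l) set" where
  "agreeing \<iota> \<sigma> S = {\<tau> \<in> carrier (galois_group \<iota>). \<forall>s\<in>S. \<tau> s = \<sigma> s}"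

text \<open>The Krull topology is the topology of pointwise convergence on a discrete field: a finite intermediate
  field is spanned by finitely many elements, and every element lies in one. All topological arguments
  below go through this description.\<close>

lemma openin_krull_topology_iff:
  fixes \<iota> :: "'k::field \<Rightarrow> 'l::field"
  assumes "separable_closure \<iota>"
  shows "openin (krull_topology \<iota>) W \<longleftrightarrow>
    W \<subseteq> carrier (galois_group \<iota>) \<and> (\<forall>\<sigma>\<in>W. \<exists>S. finite S \<and> agreeing \<iota> \<sigma> S \<subseteq> W)"
    (is "_ \<longleftrightarrow> ?P W")
proof
  have emb: "field_embedding \<iota>" using assms unfolding separable_closure_def by simp
  assume "openin (krull_topology \<iota>) W"
  then have "generate_topology_on {\<sigma> <#\<^bsub>galois_group \<iota>\<^esub> fixing_subgroup \<iota> F | \<sigma> F.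
        \<sigma> \<in> carrier (galois_group \<iota>) \<and> finite_intermediate_field \<iota> F} W"
    unfolding krull_topology_def by (rule openin_topology_generated_by)
  then show "?P W"
  proof induction
    case (Int a b)
    show ?case
    proof (intro conjI ballI)
      fix \<sigma> assume "\<sigma> \<in> a \<inter> b"
      then obtain S S' where "finite S" "agreeing \<iota> \<sigma> S \<subseteq> a" "finite S'" "agreeing \<iota> \<sigma> S' \<subseteq> b"
        using Int.IH by blast
      then show "\<exists>S. finite S \<and> agreeing \<iota> \<sigma> S \<subseteq> a \<inter> b"
        by (intro exI[of _ "S \<union> S'"]) (auto simp: agreeing_def)
    qed (use Int in auto)
  next
    case (UN K)
    then show ?case by (meson Sup_least Sup_upper UnionE order_trans)
  next
    case (Basis s)
    then obtain \<sigma> F where s: "s = \<sigma> <#\<^bsub>galois_group \<iota>\<^esub> fixing_subgroup \<iota> F"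
      "\<sigma> \<in> carrier (galois_group \<iota>)" "finite_intermediate_field \<iota> F" by blast
    obtain S where S: "finite S" "S \<subseteq> F" "\<And>\<sigma> \<tau>. \<sigma> \<in> carrier (galois_group \<iota>) \<Longrightarrow>
        \<tau> \<in> carrier (galois_group \<iota>) \<Longrightarrow> \<forall>s\<in>S. \<sigma> s = \<tau> s \<Longrightarrow> \<forall>y\<in>F. \<sigma> y = \<tau> y"
      using finite_intermediate_field_determined[OF emb s(3)] by metis
    show ?case
      unfolding s(1) coset_fixing_subgroup[OF s(2)]
    proof (intro conjI ballI)
      fix \<rho> assume \<rho>: "\<rho> \<in> {\<tau> \<in> carrier (galois_group \<iota>). \<forall>y\<in>F. \<tau> y = \<sigma> y}"
      have "\<tau> y = \<sigma> y" if "\<tau> \<in> agreeing \<iota> \<rho> S" "y \<in> F" for \<tau> y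
        using S(3)[of \<tau> \<rho>] \<rho> that by (auto simp: agreeing_def)
      then show "\<exists>S. finite S \<and> agreeing \<iota> \<rho> S \<subseteq> {\<tau> \<in> carrier (galois_group \<iota>). \<forall>y\<in>F. \<tau> y = \<sigma> y}"
        using S(1) by (intro exI[of _ S]) (auto simp: agreeing_def)
    qed auto
  qed simp
next
  assume W: "?P W"
  have "\<exists>T. openin (krull_topology \<iota>) T \<and> \<sigma> \<in> T \<and> T \<subseteq> agreeing \<iota> \<sigma> S"
    if "finite S" and \<sigma>: "\<sigma> \<in> carrier (galois_group \<iota>)" for S \<sigma>
  proof -
    have basic: "\<exists>T. openin (krull_topology \<iota>) T \<and> \<sigma> \<in> T \<and> T \<subseteq> agreeing \<iota> \<sigma> {s}" for s
    proof -
      obtain F where F: "finite_intermediate_field \<iota> F" "s \<in> F"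
        using exists_finite_intermediate_field[OF assms] by blast
      then show ?thesis
        using \<sigma> coset_fixing_subgroup[OF \<sigma>, of F] unfolding krull_topology_def
        by (intro exI[of _ "\<sigma> <#\<^bsub>galois_group \<iota>\<^esub> fixing_subgroup \<iota> F"] conjI topology_generated_by_Basis)
           (auto simp: agreeing_def)
    qed
    show ?thesis
      using \<open>finite S\<close>
    proof induction
      case empty
      then show ?case using basic[of 0] by (auto simp: agreeing_def)
    next
      case (insert s S)
      then obtain T T' where "openin (krull_topology \<iota>) T" "\<sigma> \<in> T" "T \<subseteq> agreeing \<iota> \<sigma> S"
        "openin (krull_topology \<iota>) T'" "\<sigma> \<in> T'" "T' \<subseteq> agreeing \<iota> \<sigma> {s}"
        using basic[of s] by blast
      then show ?case
        by (intro exI[of _ "T \<inter> T'"]) (auto simp: agreeing_def)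
    qed
  qed
  then show "openin (krull_topology \<iota>) W"
    using W by (subst openin_subopen) (meson order_trans subsetD)
qed

context
  fixes \<iota> :: "'k::field \<Rightarrow> 'l::field"
  assumes closure: "separable_closure \<iota>"
begin

lemma topspace_krull_topology: "topspace (krull_topology \<iota>) = carrier (galois_group \<iota>)"
proof
  show "topspace (krull_topology \<iota>) \<subseteq> carrier (galois_group \<iota>)"
    using openin_krull_topology_iff[OF closure] openin_topspace by blast
  have "openin (krull_topology \<iota>) (carrier (galois_group \<iota>))"
    unfolding openin_krull_topology_iff[OF closure] agreeing_def by blast
  then show "carrier (galois_group \<iota>) \<subseteq> topspace (krull_topology \<iota>)"
    by (rule openin_subset)
qed

lemma openin_krull_topology_evaluation:
  "openin (krull_topology \<iota>) {\<tau> \<in> carrier (galois_group \<iota>). P (\<tau> s)}"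
  unfolding openin_krull_topology_iff[OF closure]
  by (auto simp: agreeing_def intro!: exI[of _ "{s}"])

lemma closedin_krull_topology_evaluation:
  "closedin (krull_topology \<iota>) {\<tau> \<in> carrier (galois_group \<iota>). P (\<tau> s)}"
proof -
  have "carrier (galois_group \<iota>) - {\<tau> \<in> carrier (galois_group \<iota>). P (\<tau> s)} =
    {\<tau> \<in> carrier (galois_group \<iota>). \<not> P (\<tau> s)}" by blast
  then show ?thesis
    unfolding closedin_def topspace_krull_topology
    using openin_krull_topology_evaluation[of "\<lambda>a. \<not> P a" s] by auto
qed

lemma openin_agreeing:
  assumes "finite S"
  shows "openin (krull_topology \<iota>) (agreeing \<iota> \<sigma> S)"
  unfolding openin_krull_topology_iff[OF closure] using assms by (auto simp: agreeing_def)

lemma topological_group_galois_group: "topological_group (galois_group \<iota>) (krull_topology \<iota>)"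
  unfolding topological_group_def
proof (intro conjI)
  interpret group "galois_group \<iota>" by (rule group_galois_group)
  let ?G = "carrier (galois_group \<iota>)"
  show "group (galois_group \<iota>)" by (rule group_galois_group)
  show "topspace (krull_topology \<iota>) = ?G" by (rule topspace_krull_topology)
  have open_nbhd: "\<exists>S. finite S \<and> agreeing \<iota> \<sigma> S \<subseteq> U" if "openin (krull_topology \<iota>) U" "\<sigma> \<in> U" for \<sigma> U
    using that openin_krull_topology_iff[OF closure] by blast
  show "continuous_map (prod_topology (krull_topology \<iota>) (krull_topology \<iota>)) (krull_topology \<iota>)
     (\<lambda>(x, y). x \<otimes>\<^bsub>galois_group \<iota>\<^esub> y)"
    unfolding continuous_map_def
  proof (intro conjI allI impI)
    show "(\<lambda>(x, y). x \<otimes>\<^bsub>galois_group \<iota>\<^esub> y) \<in> topspace (prod_topology (krull_topology \<iota>) (krull_topology \<iota>)) \<rightarrow> topspace (krull_topology \<iota>)"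
      using m_closed by (auto simp: topspace_krull_topology simp del: galois_group_simps)
  next
    fix U assume U: "openin (krull_topology \<iota>) U"
    show "openin (prod_topology (krull_topology \<iota>) (krull_topology \<iota>))
        {x \<in> topspace (prod_topology (krull_topology \<iota>) (krull_topology \<iota>)). (case x of (x, y) \<Rightarrow> x \<otimes>\<^bsub>galois_group \<iota>\<^esub> y) \<in> U}"
      unfolding openin_prod_topology_alt
    proof (intro allI impI)
      fix \<sigma> \<tau>
      assume *: "(\<sigma>, \<tau>) \<in> {x \<in> topspace (prod_topology (krull_topology \<iota>) (krull_topology \<iota>)). (case x of (x, y) \<Rightarrow> x \<otimes>\<^bsub>galois_group \<iota>\<^esub> y) \<in> U}"
      then have st: "\<sigma> \<in> ?G" "\<tau> \<in> ?G" "\<sigma> \<circ> \<tau> \<in> U" by (auto simp: topspace_krull_topology)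
      obtain S where S: "finite S" "agreeing \<iota> (\<sigma> \<circ> \<tau>) S \<subseteq> U" using open_nbhd[OF U st(3)] by blast
      have "\<sigma>' \<circ> \<tau>' \<in> U" if "\<sigma>' \<in> agreeing \<iota> \<sigma> (\<tau> ` S)" "\<tau>' \<in> agreeing \<iota> \<tau> S" for \<sigma>' \<tau>'
        using that S(2) m_closed[of \<sigma>' \<tau>'] by (auto simp: agreeing_def)
      then show "\<exists>V W. openin (krull_topology \<iota>) V \<and> openin (krull_topology \<iota>) W \<and> \<sigma> \<in> V \<and> \<tau> \<in> W \<and>
          V \<times> W \<subseteq> {x \<in> topspace (prod_topology (krull_topology \<iota>) (krull_topology \<iota>)). (case x of (x, y) \<Rightarrow> x \<otimes>\<^bsub>galois_group \<iota>\<^esub> y) \<in> U}"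
        using st S(1)
        by (intro exI[of _ "agreeing \<iota> \<sigma> (\<tau> ` S)"] exI[of _ "agreeing \<iota> \<tau> S"])
           (auto simp: openin_agreeing topspace_krull_topology, auto simp: agreeing_def)
    qed
  qed
  show "continuous_map (krull_topology \<iota>) (krull_topology \<iota>) (\<lambda>x. inv\<^bsub>galois_group \<iota>\<^esub> x)"
    unfolding continuous_map_def topspace_krull_topology
  proof (intro conjI allI impI)
    fix U assume U: "openin (krull_topology \<iota>) U"
    show "openin (krull_topology \<iota>) {\<sigma> \<in> ?G. inv\<^bsub>galois_group \<iota>\<^esub> \<sigma> \<in> U}"
      unfolding openin_krull_topology_iff[OF closure]
    proof (intro conjI ballI)
      fix \<sigma> assume "\<sigma> \<in> {\<sigma> \<in> ?G. inv\<^bsub>galois_group \<iota>\<^esub> \<sigma> \<in> U}"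
      then have \<sigma>: "\<sigma> \<in> ?G" "inv_into UNIV \<sigma> \<in> U" by (auto simp: galois_group_inv)
      obtain S where S: "finite S" "agreeing \<iota> (inv_into UNIV \<sigma>) S \<subseteq> U" using open_nbhd[OF U \<sigma>(2)] by blast
      have "inv\<^bsub>galois_group \<iota>\<^esub> \<tau> \<in> U" if \<tau>: "\<tau> \<in> agreeing \<iota> \<sigma> (inv_into UNIV \<sigma> ` S)" for \<tau>
      proof -
        have t: "\<tau> \<in> ?G" "\<And>s. s \<in> S \<Longrightarrow> \<tau> (inv_into UNIV \<sigma> s) = s"
          using \<tau> \<sigma>(1) by (auto simp: agreeing_def galois_group_mem bij_is_surj surj_f_inv_f)
        have "inv_into UNIV \<tau> s = inv_into UNIV \<sigma> s" if "s \<in> S" for s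
          using t(2)[OF that] t(1) by (metis bij_inv_eq_iff galois_group_mem)
        moreover have "inv_into UNIV \<tau> \<in> ?G" using inv_closed[OF t(1)] galois_group_inv[OF t(1)] by simp
        ultimately show ?thesis using S(2) galois_group_inv[OF t(1)] by (auto simp: agreeing_def)
      qed
      then show "\<exists>S. finite S \<and> agreeing \<iota> \<sigma> S \<subseteq> {\<sigma> \<in> ?G. inv\<^bsub>galois_group \<iota>\<^esub> \<sigma> \<in> U}"
        using S(1) by (intro exI[of _ "inv_into UNIV \<sigma> ` S"]) (auto simp: agreeing_def)
    qed auto
  qed auto
qed

text \<open>By Tychonoff: the Galois group lies in the product over all \<open>x\<close> of the finite stable sets \<open>C x\<close>, and it
  is closed among all maps. Only surjectivity of a pointwise limit needs an argument, and it holds because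
  the limit agrees on the finite set \<open>C y\<close> with an automorphism, which permutes that set.\<close>

lemma compact_space_krull_topology: "compact_space (krull_topology \<iota>)"
proof -
  let ?G = "carrier (galois_group \<iota>)"
  let ?P = "product_topology (\<lambda>_::'l. discrete_topology (UNIV :: 'l set)) UNIV"
  have topP: "topspace ?P = UNIV" by simp
  have evalP: "openin ?P {f. f s = a}" for s a
    using openin_continuous_map_preimage[OF continuous_map_product_projection[of s UNIV "\<lambda>_. discrete_topology UNIV"], of "{a}"]
    by simp
  have agreeP: "openin ?P {f. \<forall>s\<in>S. f s = \<sigma> s}" if "finite S" for S \<sigma>
    using that
  proof induction
    case empty
    then show ?case using openin_topspace[of ?P] by simp
  next
    case (insert s S)
    have "{f. \<forall>s\<in>insert s S. f s = \<sigma> s} = {f. f s = \<sigma> s} \<inter> {f. \<forall>s\<in>S. f s = \<sigma> s}" by auto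
    then show ?case using openin_Int[OF evalP insert.IH, of s "\<sigma> s"] by simp
  qed
  obtain C where C: "\<And>x. finite (C x)" "\<And>x. x \<in> C x" "\<And>x \<sigma> s. \<sigma> \<in> ?G \<Longrightarrow> s \<in> C x \<Longrightarrow> \<sigma> s \<in> C x"
    using exists_finite_stable_superset[OF closure, of "{_}"] by (metis finite.emptyI finite_insert insert_subset)
  have limit: "\<sigma> \<in> ?G" if \<sigma>: "\<And>S. finite S \<Longrightarrow> \<exists>\<tau>\<in>?G. \<forall>s\<in>S. \<tau> s = \<sigma> s" for \<sigma>
    unfolding galois_group_mem
  proof (intro conjI allI)
    show "\<sigma> (x + y) = \<sigma> x + \<sigma> y" "\<sigma> (x * y) = \<sigma> x * \<sigma> y" for x y
      using \<sigma>[of "{x, y, x + y}"] \<sigma>[of "{x, y, x * y}"] by (auto simp: galois_group_mem)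
    show "\<sigma> (\<iota> a) = \<iota> a" for a
      using \<sigma>[of "{\<iota> a}"] by (auto simp: galois_group_mem)
    show "bij \<sigma>"
    proof (rule bijI)
      show "inj \<sigma>"
      proof (rule injI)
        fix x y assume "\<sigma> x = \<sigma> y"
        obtain \<tau> where "\<tau> \<in> ?G" "\<tau> x = \<sigma> x" "\<tau> y = \<sigma> y" using \<sigma>[of "{x, y}"] by auto
        moreover have "inj \<tau>" using \<open>\<tau> \<in> ?G\<close> by (simp add: galois_group_mem bij_is_inj)
        ultimately show "x = y" using \<open>\<sigma> x = \<sigma> y\<close> by (metis injD)
      qed
      have "y \<in> range \<sigma>" for y
      proof -
        obtain \<tau> where \<tau>: "\<tau> \<in> ?G" "\<forall>s\<in>C y. \<tau> s = \<sigma> s" using \<sigma>[OF C(1)] by blast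
        have "inj_on \<tau> (C y)" using \<tau>(1) by (auto simp: galois_group_mem bij_def intro: inj_on_subset)
        then have "\<tau> ` C y = C y" using C(1,3) \<tau>(1) by (intro endo_inj_surj) auto
        then show ?thesis using C(2)[of y] \<tau>(2) by (metis imageE rangeI)
      qed
      then show "surj \<sigma>" by blast
    qed
  qed
  have "closedin ?P ?G"
    unfolding closedin_def
  proof (intro conjI)
    show "openin ?P (topspace ?P - ?G)"
    proof (subst openin_subopen, intro ballI)
      fix \<sigma> assume "\<sigma> \<in> topspace ?P - ?G"
      then obtain S where S: "finite S" "\<not> (\<exists>\<tau>\<in>?G. \<forall>s\<in>S. \<tau> s = \<sigma> s)" using limit by blast
      then show "\<exists>T. openin ?P T \<and> \<sigma> \<in> T \<and> T \<subseteq> topspace ?P - ?G"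
        unfolding topP using agreeP[OF S(1), of \<sigma>]
        by (intro exI[of _ "{f. \<forall>s\<in>S. f s = \<sigma> s}"]) auto
    qed
  qed (simp add: topP)
  moreover have "compactin ?P (PiE UNIV C)"
    unfolding compactin_PiE using C(1) by (auto intro: finite_imp_compactin)
  moreover have "?G \<subseteq> PiE UNIV C" using C(2,3) by auto
  ultimately have "compactin ?P ?G" using closed_compactin by blast
  then have comp: "compactin (subtopology ?P ?G) ?G" by (simp add: compactin_subtopology)
  have "continuous_map (subtopology ?P ?G) (krull_topology \<iota>) id"
    unfolding continuous_map_def topspace_krull_topology
  proof (intro conjI allI impI)
    fix U assume "openin (krull_topology \<iota>) U"
    then have U: "U \<subseteq> ?G" "\<And>\<sigma>. \<sigma> \<in> U \<Longrightarrow> \<exists>S. finite S \<and> agreeing \<iota> \<sigma> S \<subseteq> U"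
      unfolding openin_krull_topology_iff[OF closure] by auto
    have "openin (subtopology ?P ?G) U"
    proof (subst openin_subopen, intro ballI)
      fix \<sigma> assume \<sigma>: "\<sigma> \<in> U"
      then obtain S where S: "finite S" "agreeing \<iota> \<sigma> S \<subseteq> U" using U(2) by blast
      have "agreeing \<iota> \<sigma> S = {f. \<forall>s\<in>S. f s = \<sigma> s} \<inter> ?G" by (auto simp: agreeing_def)
      then have "openin (subtopology ?P ?G) (agreeing \<iota> \<sigma> S)"
        using agreeP[OF S(1)] unfolding openin_subtopology by blast
      then show "\<exists>T. openin (subtopology ?P ?G) T \<and> \<sigma> \<in> T \<and> T \<subseteq> U"
        using S(2) \<sigma> U(1) by (intro exI[of _ "agreeing \<iota> \<sigma> S"]) (auto simp: agreeing_def)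
    qed
    moreover have "{x \<in> topspace (subtopology ?P ?G). id x \<in> U} = U" using U(1) by auto
    ultimately show "openin (subtopology ?P ?G) {x \<in> topspace (subtopology ?P ?G). id x \<in> U}" by simp
  qed auto
  from image_compactin[OF comp this] show ?thesis
    by (simp add: compact_space_def topspace_krull_topology)
qed

lemma profinite_group_galois_group: "profinite_group (galois_group \<iota>) (krull_topology \<iota>)"
  unfolding profinite_group_def
proof (intro conjI ballI topological_group_galois_group compact_space_krull_topology)
  let ?G = "carrier (galois_group \<iota>)"
  show "Hausdorff_space (krull_topology \<iota>)"
    unfolding Hausdorff_space_def topspace_krull_topology
  proof (intro allI impI)
    fix \<sigma> \<tau> assume st: "\<sigma> \<in> ?G \<and> \<tau> \<in> ?G \<and> \<sigma> \<noteq> \<tau>"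
    then obtain s where "\<sigma> s \<noteq> \<tau> s" by (auto simp: fun_eq_iff)
    then show "\<exists>U V. openin (krull_topology \<iota>) U \<and> openin (krull_topology \<iota>) V \<and> \<sigma> \<in> U \<and> \<tau> \<in> V \<and> disjnt U V"
      using st openin_krull_topology_evaluation[of "\<lambda>a. a = \<sigma> s" s]
        openin_krull_topology_evaluation[of "\<lambda>a. a = \<tau> s" s]
      by (intro exI[of _ "{\<rho> \<in> ?G. \<rho> s = \<sigma> s}"] exI[of _ "{\<rho> \<in> ?G. \<rho> s = \<tau> s}"])
         (auto simp: disjnt_iff)
  qed
  fix \<sigma> assume "\<sigma> \<in> topspace (krull_topology \<iota>)"
  then have \<sigma>: "\<sigma> \<in> ?G" by (simp add: topspace_krull_topology)
  let ?C = "connected_component_of_set (krull_topology \<iota>) \<sigma>"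
  have mem: "\<sigma> \<in> ?C" using \<sigma> by (simp add: connected_component_of_refl topspace_krull_topology)
  have "\<tau> = \<sigma>" if "\<tau> \<in> ?C" for \<tau>
  proof
    fix s
    have "?C \<subseteq> {\<rho> \<in> ?G. \<rho> s = \<sigma> s} \<or> disjnt ?C {\<rho> \<in> ?G. \<rho> s = \<sigma> s}"
      by (rule connectedin_clopen_cases[OF connectedin_connected_component_of
            closedin_krull_topology_evaluation openin_krull_topology_evaluation])
    then have "?C \<subseteq> {\<rho> \<in> ?G. \<rho> s = \<sigma> s}" using mem \<sigma> unfolding disjnt_iff by blast
    then show "\<tau> s = \<sigma> s" using that by blast
  qed
  then show "?C = {\<sigma>}" using mem by blast
qed

end

section \<open>Torsion in abelianizations of subgroups\<close>

locale galois_subgroup =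
  fixes \<iota> :: "'k::field \<Rightarrow> 'l::field" and K :: "('l \<Rightarrow> 'l) set"
  assumes closure: "separable_closure \<iota>" and roots: "contains_all_roots_of_unity \<iota>"
    and K: "subgroup K (galois_group \<iota>)"
begin

abbreviation (input) "H \<equiv> (galois_group \<iota>)\<lparr>carrier := K\<rparr>"
abbreviation (input) "D \<equiv> subtopology (krull_topology \<iota>) K closure_of derived H K"

lemma group_H: "group H"
  using group.subgroup_imp_group[OF group_galois_group K] .

lemma inv_H: "\<sigma> \<in> K \<Longrightarrow> inv\<^bsub>H\<^esub> \<sigma> = inv_into UNIV \<sigma>"
  using group.m_inv_consistent[OF group_galois_group K] galois_group_inv galois_subgroup_closed(5)[OF K] by metis

lemma derived_subset: "derived H K \<subseteq> K"
  using group.derived_in_carrier[OF group_H, of K] by simp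

lemma mem_closure_derived:
  "\<sigma> \<in> D \<longleftrightarrow> \<sigma> \<in> K \<and> (\<forall>S. finite S \<longrightarrow> (\<exists>\<tau>\<in>derived H K. \<forall>s\<in>S. \<tau> s = \<sigma> s))"
proof -
  have KG: "K \<subseteq> carrier (galois_group \<iota>)" using galois_subgroup_closed(5)[OF K] by blast
  have "\<sigma> \<in> D \<longleftrightarrow> \<sigma> \<in> K \<and> \<sigma> \<in> krull_topology \<iota> closure_of (derived H K)"
    using derived_subset by (simp add: closure_of_subtopology Int_absorb1)
  also have "\<dots> \<longleftrightarrow> \<sigma> \<in> K \<and> (\<forall>S. finite S \<longrightarrow> (\<exists>\<tau>\<in>derived H K. \<forall>s\<in>S. \<tau> s = \<sigma> s))"
  proof (intro conj_cong refl iffI allI impI)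
    fix S :: "'l set" assume "\<sigma> \<in> K" and cl: "\<sigma> \<in> krull_topology \<iota> closure_of (derived H K)" and S: "finite S"
    then have "\<sigma> \<in> agreeing \<iota> \<sigma> S" using KG by (auto simp: agreeing_def)
    then obtain \<tau> where "\<tau> \<in> derived H K" "\<tau> \<in> agreeing \<iota> \<sigma> S"
      using cl openin_agreeing[OF closure S] unfolding in_closure_of by blast
    then show "\<exists>\<tau>\<in>derived H K. \<forall>s\<in>S. \<tau> s = \<sigma> s" by (auto simp: agreeing_def)
  next
    assume \<sigma>: "\<sigma> \<in> K" and approx: "\<forall>S. finite S \<longrightarrow> (\<exists>\<tau>\<in>derived H K. \<forall>s\<in>S. \<tau> s = \<sigma> s)"
    show "\<sigma> \<in> krull_topology \<iota> closure_of (derived H K)"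
      unfolding in_closure_of
    proof (intro conjI allI impI)
      show "\<sigma> \<in> topspace (krull_topology \<iota>)" using \<sigma> KG topspace_krull_topology[OF closure] by auto
      fix T assume "\<sigma> \<in> T \<and> openin (krull_topology \<iota>) T"
      then obtain S where S: "finite S" "agreeing \<iota> \<sigma> S \<subseteq> T"
        using openin_krull_topology_iff[OF closure] by blast
      obtain \<tau> where "\<tau> \<in> derived H K" "\<forall>s\<in>S. \<tau> s = \<sigma> s" using approx S(1) by blast
      then show "\<exists>y. y \<in> derived H K \<and> y \<in> T"
        using S(2) derived_subset KG by (intro exI[of _ \<tau>]) (auto simp: agreeing_def)
    qed
  qed
  finally show ?thesis .
qed

lemma normal_closure_derived: "D \<lhd> H"
proof -
  interpret H: group H by (rule group_H)
  interpret d: normal "derived H K" H using H.derived_self_is_normal by simp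
  note Kc = galois_subgroup_closed[OF K]
  have bij: "bij \<sigma>" if "\<sigma> \<in> K" for \<sigma> using Kc(5)[OF that] by (simp add: galois_group_mem)
  have inv1: "inv_into UNIV \<sigma> (\<sigma> x) = x" "\<sigma> (inv_into UNIV \<sigma> x) = x" if "\<sigma> \<in> K" for \<sigma> x
    using bij[OF that] by (simp_all add: bij_is_inj bij_is_surj surj_f_inv_f)
  have comp: "\<sigma> \<circ> \<tau> \<in> D" if s: "\<sigma> \<in> D" and t: "\<tau> \<in> D" for \<sigma> \<tau>
    unfolding mem_closure_derived
  proof (intro conjI allI impI)
    show "\<sigma> \<circ> \<tau> \<in> K" using Kc(2) s t mem_closure_derived by blast
    fix S :: "'l set" assume S: "finite S"
    obtain \<tau>' where \<tau>': "\<tau>' \<in> derived H K" "\<forall>s\<in>S. \<tau>' s = \<tau> s"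
      using t S mem_closure_derived by blast
    obtain \<sigma>' where \<sigma>': "\<sigma>' \<in> derived H K" "\<forall>s\<in>\<tau> ` S. \<sigma>' s = \<sigma> s"
      using s S mem_closure_derived finite_imageI by metis
    show "\<exists>\<rho>\<in>derived H K. \<forall>s\<in>S. \<rho> s = (\<sigma> \<circ> \<tau>) s"
      using d.m_closed[OF \<sigma>'(1) \<tau>'(1)] \<sigma>'(2) \<tau>'(2) by (intro bexI[of _ "\<sigma>' \<circ> \<tau>'"]) auto
  qed
  have inv: "inv_into UNIV \<sigma> \<in> D" if s: "\<sigma> \<in> D" for \<sigma>
    unfolding mem_closure_derived
  proof (intro conjI allI impI)
    have \<sigma>K: "\<sigma> \<in> K" using s mem_closure_derived by blast
    then show "inv_into UNIV \<sigma> \<in> K" by (rule Kc(3))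
    fix S :: "'l set" assume S: "finite S"
    obtain \<sigma>' where \<sigma>': "\<sigma>' \<in> derived H K" "\<forall>s\<in>inv_into UNIV \<sigma> ` S. \<sigma>' s = \<sigma> s"
      using s S mem_closure_derived finite_imageI by metis
    have \<sigma>'K: "\<sigma>' \<in> K" using \<sigma>'(1) derived_subset by blast
    have "inv_into UNIV \<sigma>' s = inv_into UNIV \<sigma> s" if "s \<in> S" for s
    proof -
      have "\<sigma>' (inv_into UNIV \<sigma> s) = s" using \<sigma>'(2) that inv1(2)[OF \<sigma>K] by simp
      then show ?thesis using inv1(1)[OF \<sigma>'K] by metis
    qed
    then show "\<exists>\<rho>\<in>derived H K. \<forall>s\<in>S. \<rho> s = inv_into UNIV \<sigma> s"
      using d.m_inv_closed[OF \<sigma>'(1)] inv_H[OF \<sigma>'K] by (intro bexI[of _ "inv_into UNIV \<sigma>'"]) auto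
  qed
  have id: "id \<in> D" unfolding mem_closure_derived using Kc(1) d.one_closed by (auto intro!: bexI[of _ id])
  have conj: "\<rho> \<circ> \<sigma> \<circ> inv_into UNIV \<rho> \<in> D" if s: "\<sigma> \<in> D" and r: "\<rho> \<in> K" for \<sigma> \<rho>
    unfolding mem_closure_derived
  proof (intro conjI allI impI)
    show "\<rho> \<circ> \<sigma> \<circ> inv_into UNIV \<rho> \<in> K"
      using Kc(2)[OF Kc(2)[OF r] Kc(3)[OF r]] s mem_closure_derived by blast
    fix S :: "'l set" assume S: "finite S"
    obtain \<sigma>' where \<sigma>': "\<sigma>' \<in> derived H K" "\<forall>s\<in>inv_into UNIV \<rho> ` S. \<sigma>' s = \<sigma> s"
      using s S mem_closure_derived finite_imageI by metis
    show "\<exists>\<tau>\<in>derived H K. \<forall>s\<in>S. \<tau> s = (\<rho> \<circ> \<sigma> \<circ> inv_into UNIV \<rho>) s"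
      using d.inv_op_closed2[OF _ \<sigma>'(1), of \<rho>] r inv_H[OF r] \<sigma>'(2)
      by (intro bexI[of _ "\<rho> \<circ> \<sigma>' \<circ> inv_into UNIV \<rho>"]) auto
  qed
  show ?thesis
    unfolding H.normal_inv_iff
  proof (intro conjI ballI)
    show "subgroup D H"
    proof (rule H.subgroupI)
      have DK: "\<sigma> \<in> K" if "\<sigma> \<in> D" for \<sigma> using that mem_closure_derived by blast
      then show "D \<subseteq> carrier H" by (simp add: subset_eq)
      show "D \<noteq> {}" using id by (metis empty_iff)
      show "inv\<^bsub>H\<^esub> \<sigma> \<in> D" if "\<sigma> \<in> D" for \<sigma> using inv[OF that] inv_H[OF DK[OF that]] by (simp only:)
      show "\<sigma> \<otimes>\<^bsub>H\<^esub> \<tau> \<in> D" if "\<sigma> \<in> D" "\<tau> \<in> D" for \<sigma> \<tau> using comp[OF that] by simp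
    qed
    show "\<rho> \<otimes>\<^bsub>H\<^esub> \<sigma> \<otimes>\<^bsub>H\<^esub> inv\<^bsub>H\<^esub> \<rho> \<in> D" if "\<rho> \<in> carrier H" "\<sigma> \<in> D" for \<rho> \<sigma>
      using conj[OF that(2)] that(1) inv_H by simp
  qed
qed

text \<open>If \<open>K\<close> acts commutatively on \<open>w\<close>, it does so on the whole orbit of \<open>w\<close>, in particular on the
  translate of \<open>w\<close> that occurs when a commutator is evaluated at \<open>w\<close>.\<close>

lemma derived_fixes_if_commuting:
  assumes comm: "\<And>\<sigma> \<tau>. \<sigma> \<in> K \<Longrightarrow> \<tau> \<in> K \<Longrightarrow> \<sigma> (\<tau> w) = \<tau> (\<sigma> w)" and \<delta>: "\<delta> \<in> derived H K"
  shows "\<delta> w = w"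
proof -
  interpret H: group H by (rule group_H)
  note Kc = galois_subgroup_closed[OF K]
  have inv1: "inv_into UNIV \<sigma> (\<sigma> x) = x" "\<sigma> (inv_into UNIV \<sigma> x) = x" if "\<sigma> \<in> K" for \<sigma> x
    using Kc(5)[OF that] by (simp_all add: galois_group_mem bij_is_inj bij_is_surj surj_f_inv_f)
  have "subgroup {\<sigma> \<in> K. \<sigma> w = w} H"
  proof (rule H.subgroupI)
    show "inv\<^bsub>H\<^esub> \<sigma> \<in> {\<sigma> \<in> K. \<sigma> w = w}" if "\<sigma> \<in> {\<sigma> \<in> K. \<sigma> w = w}" for \<sigma>
      using that inv_H Kc(3) inv1 by (metis (mono_tags, lifting) mem_Collect_eq)
  qed (use Kc in auto)
  moreover have "derived_set H K \<subseteq> {\<sigma> \<in> K. \<sigma> w = w}"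
  proof
    fix \<delta> assume "\<delta> \<in> derived_set H K"
    then obtain \<sigma> \<tau> where st: "\<sigma> \<in> K" "\<tau> \<in> K" "\<delta> = \<sigma> \<circ> \<tau> \<circ> inv_into UNIV \<sigma> \<circ> inv_into UNIV \<tau>"
      using inv_H by auto
    let ?\<rho> = "inv_into UNIV \<sigma> \<circ> inv_into UNIV \<tau>"
    have \<rho>: "?\<rho> \<in> K" using Kc(2)[OF Kc(3) Kc(3)] st by blast
    have "\<delta> w = \<sigma> (\<tau> (?\<rho> w))" using st(3) by simp
    also have "\<dots> = \<sigma> (?\<rho> (\<tau> w))" using comm[OF st(2) \<rho>] by simp
    also have "\<dots> = ?\<rho> (\<tau> (\<sigma> w))"
      using comm[OF st(1) Kc(2)[OF \<rho> st(2)]] by simp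
    also have "\<dots> = ?\<rho> (\<sigma> (\<tau> w))" using comm[OF st(1,2)] by simp
    also have "\<dots> = (?\<rho> \<circ> \<sigma>) (\<tau> w)" by simp
    also have "\<dots> = \<tau> ((?\<rho> \<circ> \<sigma>) w)" using comm[OF st(2) Kc(2)[OF \<rho> st(1)]] by simp
    also have "\<dots> = \<tau> (?\<rho> (\<sigma> w))" by simp
    also have "\<dots> = \<tau> (\<sigma> (?\<rho> w))" using comm[OF st(1) \<rho>] by simp
    also have "\<dots> = w" using inv1[OF st(1)] inv1[OF st(2)] by simp
    finally have "\<delta> w = w" .
    moreover have "\<delta> \<in> K" unfolding st(3) using Kc(2)[OF Kc(2)[OF Kc(2)[OF st(1,2)] Kc(3)[OF st(1)]] Kc(3)[OF st(2)]] .
    ultimately show "\<delta> \<in> {\<sigma> \<in> K. \<sigma> w = w}" by simp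
  qed
  ultimately show ?thesis
    using \<delta> H.generate_subgroup_incl unfolding derived_def by blast
qed

text \<open>If \<open>x\<close> is not in \<open>D\<close>, then some finite set \<open>S\<close>, which may be taken stable, separates \<open>x\<close> from the
  derived subgroup. The elements of \<open>K\<close> that agree on \<open>S\<close> with an element of the derived subgroup form a
  subgroup \<open>N\<close> of finite index, and \<open>x\<close> defines an element of order \<open>p\<close> in the finite abelian group \<open>K / N\<close>.
  A cyclic layer above \<open>N\<close> that detects \<open>x\<close> yields an element \<open>w\<close> on which \<open>K\<close> acts commutatively and which
  \<open>x ^^ p\<close> moves. But \<open>x ^^ p\<close> agrees at \<open>w\<close> with an element of the derived subgroup, which fixes \<open>w\<close>.\<close>

theorem prime_torsion_in_closure_derived:
  assumes p: "Factorial_Ring.prime p" and x: "x \<in> K" "x ^^ p \<in> D"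
  shows "x \<in> D"
proof (rule ccontr)
  assume "x \<notin> D"
  interpret H: group H by (rule group_H)
  interpret d: normal "derived H K" H using H.derived_self_is_normal by simp
  interpret D: normal D H by (rule normal_closure_derived)
  note Kc = galois_subgroup_closed[OF K]
  obtain A where A: "finite A" "\<And>\<tau>. \<tau> \<in> derived H K \<Longrightarrow> \<exists>s\<in>A. \<tau> s \<noteq> x s"
  proof -
    have "\<not> (\<forall>S. finite S \<longrightarrow> (\<exists>\<tau>\<in>derived H K. \<forall>s\<in>S. \<tau> s = x s))"
      using \<open>x \<notin> D\<close> x(1) unfolding mem_closure_derived by simp
    then show thesis using that by metis
  qed
  obtain S where S: "finite S" "A \<subseteq> S" "\<And>\<sigma> s. \<sigma> \<in> K \<Longrightarrow> s \<in> S \<Longrightarrow> \<sigma> s \<in> S"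
  proof -
    obtain S where "finite S" "A \<subseteq> S" "\<forall>\<sigma>\<in>carrier (galois_group \<iota>). \<forall>s\<in>S. \<sigma> s \<in> S"
      using exists_finite_stable_superset[OF closure A(1)] by (elim exE conjE)
    then show thesis using that[of S] Kc(5) by simp
  qed
  define N where "N = {\<sigma> \<in> K. \<exists>\<tau>\<in>derived H K. \<forall>s\<in>S. \<tau> s = \<sigma> s}"
  have inv1: "inv_into UNIV \<sigma> (\<sigma> y) = y" "\<sigma> (inv_into UNIV \<sigma> y) = y" if "\<sigma> \<in> K" for \<sigma> y
    using Kc(5)[OF that] by (simp_all add: galois_group_mem bij_is_inj bij_is_surj surj_f_inv_f)
  have N: "subgroup N H"
  proof (rule H.subgroupI)
    show "N \<noteq> {}" unfolding N_def using Kc(1) d.one_closed by auto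
    fix \<sigma> assume \<sigma>: "\<sigma> \<in> N"
    then obtain \<tau> where t: "\<tau> \<in> derived H K" "\<forall>s\<in>S. \<tau> s = \<sigma> s" "\<sigma> \<in> K" unfolding N_def by blast
    have tK: "\<tau> \<in> K" using t derived_subset by blast
    have "inv_into UNIV \<tau> s = inv_into UNIV \<sigma> s" if "s \<in> S" for s
    proof -
      have "\<tau> (inv_into UNIV \<sigma> s) = \<sigma> (inv_into UNIV \<sigma> s)" using t(2) S(3)[OF Kc(3)[OF t(3)] that] by blast
      then show ?thesis using inv1[OF tK] inv1[OF t(3)] by metis
    qed
    then show "inv\<^bsub>H\<^esub> \<sigma> \<in> N"
      unfolding N_def using d.m_inv_closed[OF t(1)] inv_H[OF tK] inv_H[OF t(3)] Kc(3)[OF t(3)] by auto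
    fix \<sigma>' assume "\<sigma>' \<in> N"
    then obtain \<tau>' where t': "\<tau>' \<in> derived H K" "\<forall>s\<in>S. \<tau>' s = \<sigma>' s" "\<sigma>' \<in> K" unfolding N_def by blast
    have "\<forall>s\<in>S. (\<tau> \<circ> \<tau>') s = (\<sigma> \<circ> \<sigma>') s"
      using t(2) t'(2) S(3)[OF t'(3)] by simp
    moreover have "\<tau> \<circ> \<tau>' \<in> derived H K" using d.m_closed[OF t(1) t'(1)] by simp
    ultimately show "\<sigma> \<otimes>\<^bsub>H\<^esub> \<sigma>' \<in> N"
      unfolding N_def using Kc(2)[OF t(3) t'(3)] by (auto intro!: bexI[of _ "\<tau> \<circ> \<tau>'"])
  qed (auto simp: N_def)
  have dN: "derived H (carrier H) \<subseteq> N" unfolding N_def using derived_subset by auto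
  have finN: "finite (rcosets\<^bsub>H\<^esub> N)"
  proof -
    \<comment> \<open>The coset of \<open>\<sigma>\<close> depends only on how \<open>\<sigma>\<close> permutes \<open>S\<close>.\<close>
    have same: "N #>\<^bsub>H\<^esub> \<sigma> = N #>\<^bsub>H\<^esub> \<tau>" if st: "\<sigma> \<in> K" "\<tau> \<in> K" "restrict \<sigma> S = restrict \<tau> S" for \<sigma> \<tau>
    proof -
      have "\<tau> \<circ> inv_into UNIV \<sigma> \<in> N"
        unfolding N_def
      proof (intro CollectI conjI bexI[of _ id] ballI)
        show "\<tau> \<circ> inv_into UNIV \<sigma> \<in> K" by (rule Kc(2)[OF st(2) Kc(3)[OF st(1)]])
        fix s assume "s \<in> S"
        then have "\<tau> (inv_into UNIV \<sigma> s) = \<sigma> (inv_into UNIV \<sigma> s)"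
          using st(3) S(3)[OF Kc(3)[OF st(1)]] by (metis restrict_apply')
        then show "id s = (\<tau> \<circ> inv_into UNIV \<sigma>) s" using inv1[OF st(1)] by simp
      qed (use d.one_closed in simp)
      moreover have "\<tau> = (\<tau> \<circ> inv_into UNIV \<sigma>) \<circ> \<sigma>" using inv1[OF st(1)] by (simp add: fun_eq_iff)
      ultimately have "\<tau> \<in> N #>\<^bsub>H\<^esub> \<sigma>" unfolding r_coset_def by auto
      then show ?thesis using H.repr_independence[OF _ _ N] st(1) by simp
    qed
    have "rcosets\<^bsub>H\<^esub> N \<subseteq> (\<lambda>f. N #>\<^bsub>H\<^esub> (SOME \<sigma>. \<sigma> \<in> K \<and> restrict \<sigma> S = f)) ` (S \<rightarrow>\<^sub>E S)"
    proof
      fix C assume "C \<in> rcosets\<^bsub>H\<^esub> N"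
      then obtain \<tau> where t: "\<tau> \<in> K" "C = N #>\<^bsub>H\<^esub> \<tau>" unfolding RCOSETS_def by auto
      let ?\<sigma> = "SOME \<sigma>. \<sigma> \<in> K \<and> restrict \<sigma> S = restrict \<tau> S"
      have "?\<sigma> \<in> K \<and> restrict ?\<sigma> S = restrict \<tau> S" by (rule someI[of _ \<tau>]) (simp add: t(1))
      then have "C = N #>\<^bsub>H\<^esub> ?\<sigma>" using same[of ?\<sigma> \<tau>] t by simp
      moreover have "restrict \<tau> S \<in> S \<rightarrow>\<^sub>E S" using S(3)[OF t(1)] by auto
      ultimately show "C \<in> (\<lambda>f. N #>\<^bsub>H\<^esub> (SOME \<sigma>. \<sigma> \<in> K \<and> restrict \<sigma> S = f)) ` (S \<rightarrow>\<^sub>E S)"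
        by blast
    qed
    moreover have "finite (S \<rightarrow>\<^sub>E S)" using S(1) by (intro finite_PiE)
    ultimately show ?thesis by (meson finite_surj)
  qed
  have powH: "\<sigma> [^]\<^bsub>H\<^esub> n = \<sigma> ^^ n" for \<sigma> and n :: nat by (rule galois_group_pow)
  have "x \<in> carrier H" "x \<notin> N" "x [^]\<^bsub>H\<^esub> p \<in> N"
  proof -
    show "x \<notin> N" using A(2) S(2) unfolding N_def by fastforce
    show "x [^]\<^bsub>H\<^esub> p \<in> N"
      using x(2) S(1) unfolding powH N_def mem_closure_derived by blast
  qed (use x in simp)
  then obtain V g r where V: "V \<lhd> H" "N \<subseteq> V" "x \<notin> V" "g \<in> carrier H"
    "\<forall>a\<in>carrier H. \<exists>i::nat. \<exists>v\<in>V. a = v \<otimes>\<^bsub>H\<^esub> g [^]\<^bsub>H\<^esub> i" "\<forall>i::nat. g [^]\<^bsub>H\<^esub> i \<in> V \<longleftrightarrow> p ^ r dvd i"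
    using H.exists_cyclic_prime_power_quotient[OF N dN finN p] by blast
  interpret V: normal V H by (rule V(1))
  have VK: "V \<subseteq> K" using V.subset by simp
  have sV: "subgroup V (galois_group \<iota>)"
    using group.incl_subgroup[OF group_galois_group K V.subgroup_axioms] .
  interpret cyclic_layer \<iota> K V g p r
  proof (rule cyclic_layer.intro)
    show "\<exists>v'\<in>V. v \<circ> \<sigma> = \<sigma> \<circ> v'" if s: "\<sigma> \<in> K" "v \<in> V" for \<sigma> v
    proof
      show "inv_into UNIV \<sigma> \<circ> v \<circ> \<sigma> \<in> V"
        using V.inv_op_closed1[of \<sigma> v] s inv_H[OF s(1)] by simp
      show "v \<circ> \<sigma> = \<sigma> \<circ> (inv_into UNIV \<sigma> \<circ> v \<circ> \<sigma>)" using inv1[OF s(1)] by (simp add: fun_eq_iff)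
    qed
    show "\<exists>i. \<exists>v\<in>V. \<sigma> = v \<circ> g ^^ i" if "\<sigma> \<in> K" for \<sigma>
      using V(5) that unfolding powH by simp
    show "g ^^ i \<in> V \<longleftrightarrow> p ^ r dvd i" for i using V(6) unfolding powH by simp
    show "\<exists>y. (\<forall>v\<in>V. v y = y) \<and> \<sigma> y \<noteq> y" if "\<sigma> \<in> K" "\<sigma> \<notin> V" for \<sigma>
    proof (rule fixed_field_separates[OF K sV VK S(1)])
      show "\<sigma> \<in> K" "\<sigma> \<notin> V" using that by auto
      show "\<tau> s \<in> S" if "\<tau> \<in> K" "s \<in> S" for \<tau> s using S(3) that .
      fix \<tau> assume "\<tau> \<in> K" "\<forall>s\<in>S. \<tau> s = s"
      then have "\<tau> \<in> N" unfolding N_def using d.one_closed by (auto intro!: bexI[of _ id])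
      then show "\<tau> \<in> V" using V(2) by blast
    qed
  qed (use closure roots K VK V(4) p in simp_all)
  have "x ^^ p \<in> N" using \<open>x [^]\<^bsub>H\<^esub> p \<in> N\<close> unfolding powH .
  then have "x ^^ p \<in> V" using V(2) by blast
  then obtain w where w: "\<forall>\<sigma>\<in>K. \<forall>\<tau>\<in>K. \<sigma> (\<tau> w) = \<tau> (\<sigma> w)" "(x ^^ p) w \<noteq> w"
    using kummer_witness[OF _ x(1) V(3)] artin_schreier_witness[OF _ x(1) V(3)] by metis
  obtain \<delta> where \<delta>: "\<delta> \<in> derived H K" "\<forall>s\<in>{w}. \<delta> s = (x ^^ p) s"
    using x(2) finite.intros(1)[THEN finite.intros(2)] unfolding mem_closure_derived by metis
  have "\<delta> w = w" using derived_fixes_if_commuting[OF _ \<delta>(1)] w(1) by blast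
  then show False using \<delta>(2) w(2) by simp
qed

lemma torsion_in_closure_derived:
  assumes "n > 0" "x \<in> K" "x ^^ n \<in> D"
  shows "x \<in> D"
  using assms
proof (induction n arbitrary: x rule: less_induct)
  case (less n)
  show ?case
  proof (cases "n = 1")
    case True
    then show ?thesis using less.prems by simp
  next
    case False
    then obtain p where p: "Factorial_Ring.prime p" "p dvd n" using prime_factor_nat by blast
    then obtain m where m: "n = m * p" by (metis dvdE mult.commute)
    have m0: "0 < m" "m < n" using m less.prems(1) prime_gt_1_nat[OF p(1)] by auto
    have "(x ^^ m) ^^ p \<in> D" using less.prems(3) m by (simp add: funpow_mult)
    then have "x ^^ m \<in> D"
      using prime_torsion_in_closure_derived[OF p(1)] galois_subgroup_closed(4)[OF K less.prems(2)] by blast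
    then show ?thesis using less.IH[OF m0(2,1) less.prems(2)] by blast
  qed
qed

lemma torsion_free_profinite_abelianization:
  "torsion_free_group (profinite_abelianization H (subtopology (krull_topology \<iota>) K))"
proof -
  interpret H: group H by (rule group_H)
  interpret D: normal D H by (rule normal_closure_derived)
  have "profinite_abelianization H (subtopology (krull_topology \<iota>) K) = H Mod D"
    by (simp add: profinite_abelianization_def)
  moreover have "D #>\<^bsub>H\<^esub> x = D" if x: "x \<in> K" and n: "n > 0" "(D #>\<^bsub>H\<^esub> x) [^]\<^bsub>H Mod D\<^esub> n = D" for x and n :: nat
  proof -
    have "D #>\<^bsub>H\<^esub> (x ^^ n) = D" using n(2) x D.FactGroup_pow[of x n] by (simp add: galois_group_pow)
    then have "x ^^ n \<in> D"
      using H.coset_join1[OF _ _ D.subgroup_axioms] galois_subgroup_closed(4)[OF K x] by simp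
    then have "x \<in> D" using torsion_in_closure_derived n(1) x by blast
    then show ?thesis using H.coset_join2[OF _ D.subgroup_axioms] x by simp
  qed
  ultimately show ?thesis
    unfolding torsion_free_group_def by (auto simp: carrier_FactGroup)
qed

end

theorem proposition3p1:
  fixes \<iota> :: "'k::field \<Rightarrow> 'l::field"
  assumes "separable_closure \<iota>"
    and "contains_all_roots_of_unity \<iota>"
  shows "totally_torsion_free (galois_group \<iota>) (krull_topology \<iota>)"
  unfolding totally_torsion_free_def
  using profinite_group_galois_group[OF assms(1)]
    galois_subgroup.torsion_free_profinite_abelianization[OF galois_subgroup.intro[OF assms]] by blast

end
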